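(* Let $n$ be an odd number and $h_n:=(n-1)/2$. Let $\ell,s$ be integers with $0\le\ell\le h_n-2$, $0\le s\le h_n-1$ and $s+\ell<h_n$. Let $U\subseteq\mathbb R^{n+1}$ be an axially symmetric open set and $f$ a left (resp. right) slice hyperholomorphic function on $U$. Then $D^s\overline D^{\,h_n-\ell-1}f$ (resp. $f\,D^s\overline D^{\,h_n-\ell-1}$, operators acting from the right) is a left (resp. right) axially polyanalytic holomorphic Cliffordian function of order $(\ell+1,\,h_n-s-\ell)$ in $U$.
   Context: $\mathbb R_n$ is the real Clifford algebra generated by $e_1,\dots,e_n$ with $e_ie_j+e_je_i=-2\delta_{ij}$. A point $(x_0,\dots,x_n)\in\mathbb R^{n+1}$ is identified with the paravector $x=x_0+\underline x$, $\underline x=\sum_{j=1}^n x_je_j$. $\mathbb S$ is the set of $\underline x$ with $|\underline x|=1$. $[x]=\{x_0+I|\underline x|: I\in\mathbb S\}$. An open $U\subset\mathbb R^{n+1}$ is axially symmetric if $[x]\subset U$ for all $x\in U$. For such $U$ let $\mathcal U=\{(u,v)\in\mathbb R^2: u+\mathbb S v\subset U\}$. $f:U\to\mathbb R_n$ is left (resp. right) slice hyperholomorphic if $f(u+Iv)=\alpha(u,v)+I\beta(u,v)$ (resp. $\alpha(u,v)+\beta(u,v)I$) for all $I\in\mathbb S$, $(u,v)\in\mathcal U$, with differentiable $\alpha,\beta:\mathcal U\to\mathbb R_n$ satisfying $\alpha(u,-v)=\alpha(u,v)$, $\beta(u,-v)=-\beta(u,v)$ and $\partial_u\alpha=\partial_v\beta$,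 $\partial_v\alpha=-\partial_u\beta$. $Df=\partial_{x_0}f+\sum_{i=1}^ne_i\partial_{x_i}f$, $\overline Df=\partial_{x_0}f-\sum_{i=1}^ne_i\partial_{x_i}f$; acting from the right, $fD=\partial_{x_0}f+\sum_i\partial_{x_i}f\,e_i$, $f\overline D=\partial_{x_0}f-\sum_i\partial_{x_i}f\,e_i$. $\Delta_{n+1}=\sum_{j=0}^n\partial_{x_j}^2=D\overline D=\overline DD$. For integers $k,m\ge0$, a function $g:U\to\mathbb R_n$ of class $\mathcal C^{2k+m}$ is left (resp. right) axially polyanalytic holomorphic Cliffordian of order $(k,m)$ if $\Delta_{n+1}^kD^mg=0$ (resp. $g\,\Delta_{n+1}^kD^m=0$) on $U$ and $g$ is of left (resp. right) axial form: $g(x)=A(x_0,|\underline x|)+\underline\omega B(x_0,|\underline x|)$ (resp. $A+B\underline\omega$), $\underline\omega=\underline x/|\underline x|$, with $\mathbb R_n$-valued $A$ even and $B$ odd in the second variable. *)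

theory Defs
  imports "HOL-Analysis.Analysis"
begin

section \<open>The real Clifford algebra\<close>

text \<open>
  The generators are indexed by a finite linearly ordered type \<open>'n\<close>, so the algebra
  $\mathbb{R}_n$ with $n = $ \<open>CARD('n)\<close> is \<open>'n clifford\<close>.  An element is given by its coordinates
  with respect to the basis $e_A = e_{a_1} \cdots e_{a_r}$, where
  $A = \{a_1 < \dots < a_r\} \subseteq$ \<open>'n\<close>.
\<close>

typedef ('n::finite) clifford = "UNIV :: (real, 'n set) vec set"
  morphisms coords of_coords ..

setup_lifting type_definition_clifford

text \<open>
  $e_A e_B = \pm e_{A \mathbin{\triangle} B}$; reordering the generators contributes one sign for each
  pair $a \in A$, $b \in B$ with $b < a$, and $e_a^2 = -1$ one for each $a \in A \cap B$.
\<close>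

definition clifford_sign :: "'n::{finite,linorder} set \<Rightarrow> 'n set \<Rightarrow> real" where
  "clifford_sign A B = (-1) ^ card {(a, b). a \<in> A \<and> b \<in> B \<and> b \<le> a}"

lemma clifford_sign_empty [simp]: "clifford_sign {} B = 1" "clifford_sign A {} = 1"
  by (simp_all add: clifford_sign_def)

lemma clifford_sign_alt:
  "clifford_sign A B = (\<Prod>a\<in>UNIV. \<Prod>b\<in>UNIV. if a \<in> A \<and> b \<in> B \<and> b \<le> a then -1 else 1)"
proof -
  have "(\<Prod>a\<in>UNIV. \<Prod>b\<in>UNIV. if a \<in> A \<and> b \<in> B \<and> b \<le> a then -1 else 1)
      = (\<Prod>p\<in>UNIV \<times> UNIV. if p \<in> {(a, b). a \<in> A \<and> b \<in> B \<and> b \<le> a} then -1 else (1::real))"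
    by (simp only: prod.cartesian_product) (rule prod.cong, simp_all add: case_prod_beta)
  also have "\<dots> = (\<Prod>p\<in>{(a, b). a \<in> A \<and> b \<in> B \<and> b \<le> a}. -1)"
    by (intro prod.mono_neutral_cong_right) (auto split: if_splits)
  finally show ?thesis
    by (simp add: clifford_sign_def)
qed

lemma clifford_sign_sym_diff:
  "clifford_sign (sym_diff A B) C = clifford_sign A C * clifford_sign B C"
  "clifford_sign A (sym_diff B C) = clifford_sign A B * clifford_sign A C"
  unfolding clifford_sign_alt prod.distrib [symmetric]
  by (auto intro!: prod.cong)

instantiation clifford :: (finite) real_vector
begin

lift_definition zero_clifford :: "'a clifford" is 0 .
lift_definition plus_clifford :: "'a clifford \<Rightarrow> 'a clifford \<Rightarrow> 'a clifford" is "(+)" .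
lift_definition minus_clifford :: "'a clifford \<Rightarrow> 'a clifford \<Rightarrow> 'a clifford" is "(-)" .
lift_definition uminus_clifford :: "'a clifford \<Rightarrow> 'a clifford" is uminus .
lift_definition scaleR_clifford :: "real \<Rightarrow> 'a clifford \<Rightarrow> 'a clifford" is scaleR .

instance
  by standard (transfer; simp add: algebra_simps)+

end

instantiation clifford :: (finite) euclidean_space
begin

lift_definition inner_clifford :: "'a clifford \<Rightarrow> 'a clifford \<Rightarrow> real" is inner .
lift_definition norm_clifford :: "'a clifford \<Rightarrow> real" is norm .
lift_definition Basis_clifford :: "'a clifford set" is Basis .
definition dist_clifford :: "'a clifford \<Rightarrow> 'a clifford \<Rightarrow> real"
  where "dist_clifford x y = norm (x - y)"
definition sgn_clifford :: "'a clifford \<Rightarrow> 'a clifford"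
  where "sgn_clifford x = x /\<^sub>R norm x"
definition uniformity_clifford :: "('a clifford \<times> 'a clifford) filter"
  where "uniformity_clifford = (INF e\<in>{0<..}. principal {(x, y). dist x y < e})"
definition open_clifford :: "'a clifford set \<Rightarrow> bool"
  where "open_clifford S \<longleftrightarrow> (\<forall>x\<in>S. \<forall>\<^sub>F (x', y) in uniformity. x' = x \<longrightarrow> y \<in> S)"

instance
proof
  fix x y z :: "'a clifford" and r :: real and S :: "'a clifford set"
  show "dist x y = norm (x - y)" by (rule dist_clifford_def)
  show "sgn x = x /\<^sub>R norm x" by (rule sgn_clifford_def)
  show "uniformity = (INF e\<in>{0<..}. principal {(x :: 'a clifford, y). dist x y < e})"
    by (rule uniformity_clifford_def)
  show "open S \<longleftrightarrow> (\<forall>x\<in>S. \<forall>\<^sub>F (x', y) in uniformity. x' = x \<longrightarrow> y \<in> S)"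
    by (rule open_clifford_def)
  show "inner x y = inner y x" by transfer (rule inner_commute)
  show "inner (x + y) z = inner x z + inner y z" by transfer (rule inner_add_left)
  show "inner (r *\<^sub>R x) y = r * inner x y" by transfer simp
  show "0 \<le> inner x x" by transfer simp
  show "inner x x = 0 \<longleftrightarrow> x = 0" by transfer simp
  show "norm x = sqrt (inner x x)" by transfer (rule norm_eq_sqrt_inner)
  show "(Basis :: 'a clifford set) \<noteq> {}" by transfer simp
  show "finite (Basis :: 'a clifford set)" by transfer simp
  show "(\<forall>u\<in>Basis. inner x u = 0) \<longleftrightarrow> x = 0" by transfer (rule euclidean_all_zero_iff)
next
  fix u v :: "'a clifford"
  assume "u \<in> Basis" "v \<in> Basis"
  then show "inner u v = (if u = v then 1 else 0)"
    by transfer (rule inner_Basis)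
qed

end

instantiation clifford :: ("{finite,linorder}") real_algebra_1
begin

lift_definition one_clifford :: "'a clifford" is "axis {} 1" .

lift_definition times_clifford :: "'a clifford \<Rightarrow> 'a clifford \<Rightarrow> 'a clifford"
  is "\<lambda>x y. \<chi> C. \<Sum>(A, B) | sym_diff A B = C. clifford_sign A B * x $ A * y $ B" .

lemma clifford_pairs_eq:
  "(\<Sum>(A, B) | sym_diff A B = C. F A B) = (\<Sum>A\<in>UNIV. F A (sym_diff A C))"
  for F :: "'a set \<Rightarrow> 'a set \<Rightarrow> real"
proof (rule sum.reindex_bij_witness [of _ "\<lambda>A. (A, sym_diff A C)" fst])
  show "F (fst p) (sym_diff (fst p) C) = (case p of (A, B) \<Rightarrow> F A B)"
    if "p \<in> {(A, B). sym_diff A B = C}" for p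
  proof -
    have "sym_diff (fst p) C = snd p"
      using that by auto
    then show ?thesis
      by (simp add: case_prod_beta)
  qed
qed auto

instance
proof
  fix x y z :: "'a clifford" and r :: real
  show "x * y * z = x * (y * z)"
  proof (transfer, simp only: clifford_pairs_eq, rule vec_eq_iff [THEN iffD2], rule allI)
    fix x y z :: "(real, 'a set) vec" and E :: "'a set"
    have swap: "(\<Sum>C\<in>UNIV. F C) = (\<Sum>B\<in>UNIV. F (sym_diff A B))"
      for F :: "'a set \<Rightarrow> real" and A
      by (rule sum.reindex_bij_witness [of _ "\<lambda>B. sym_diff A B" "\<lambda>B. sym_diff A B"])
        (auto intro!: arg_cong [of _ _ F])
    have assoc: "sym_diff (sym_diff A B) E = sym_diff B (sym_diff A E)" for A B
      by blast
    have canc: "sym_diff A (sym_diff A B) = B" for A B :: "'a set"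
      by blast
    have "(\<Sum>C\<in>UNIV. clifford_sign C (sym_diff C E) *
              (\<Sum>A\<in>UNIV. clifford_sign A (sym_diff A C) * x $ A * y $ (sym_diff A C)) *
              z $ (sym_diff C E))
        = (\<Sum>A\<in>UNIV. \<Sum>C\<in>UNIV. clifford_sign C (sym_diff C E) *
              (clifford_sign A (sym_diff A C) * x $ A * y $ (sym_diff A C)) *
              z $ (sym_diff C E))"
      by (simp only: sum_distrib_left sum_distrib_right) (rule sum.swap)
    also have "\<dots> = (\<Sum>A\<in>UNIV. \<Sum>B\<in>UNIV.
              clifford_sign (sym_diff A B) (sym_diff (sym_diff A B) E) *
              (clifford_sign A (sym_diff A (sym_diff A B)) * x $ A *
                 y $ (sym_diff A (sym_diff A B))) *
              z $ (sym_diff (sym_diff A B) E))"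
      by (rule sum.cong [OF refl], rule swap)
    also have "\<dots> = (\<Sum>A\<in>UNIV. \<Sum>B\<in>UNIV. clifford_sign A (sym_diff A E) * x $ A *
              (clifford_sign B (sym_diff B (sym_diff A E)) * y $ B *
              z $ (sym_diff B (sym_diff A E))))"
    proof (intro sum.cong refl)
      fix A B :: "'a set"
      have "clifford_sign (sym_diff A B) (sym_diff (sym_diff A B) E) * clifford_sign A B =
            clifford_sign A (sym_diff A E) * clifford_sign B (sym_diff B (sym_diff A E))"
      proof -
        have sq: "clifford_sign P Q * clifford_sign P Q = 1" for P Q :: "'a set"
          by (simp add: clifford_sign_def flip: power_mult_distrib)
        have "clifford_sign A B * clifford_sign A B * t = t" for t
          by (simp add: sq)
        then show ?thesis
          by (simp only: clifford_sign_sym_diff) (simp add: mult_ac)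
      qed
      then show "clifford_sign (sym_diff A B) (sym_diff (sym_diff A B) E) *
              (clifford_sign A (sym_diff A (sym_diff A B)) * x $ A *
                 y $ (sym_diff A (sym_diff A B))) *
              z $ (sym_diff (sym_diff A B) E) =
              clifford_sign A (sym_diff A E) * x $ A *
              (clifford_sign B (sym_diff B (sym_diff A E)) * y $ B *
              z $ (sym_diff B (sym_diff A E)))"
        unfolding canc assoc by (simp add: mult_ac)
    qed
    finally show "(\<chi> C. \<Sum>A\<in>UNIV. clifford_sign A (sym_diff A C) *
           (\<chi> C. \<Sum>A\<in>UNIV. clifford_sign A (sym_diff A C) * x $ A * y $ (sym_diff A C)) $ A *
           z $ (sym_diff A C)) $ E =
       (\<chi> C. \<Sum>A\<in>UNIV. clifford_sign A (sym_diff A C) * x $ A *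
           (\<chi> C. \<Sum>A\<in>UNIV. clifford_sign A (sym_diff A C) * y $ A * z $ (sym_diff A C))
             $ (sym_diff A C)) $ E"
      by (simp add: sum_distrib_left)
  qed
  show "1 * x = x"
    by (transfer, simp only: clifford_pairs_eq)
      (simp add: vec_eq_iff axis_def if_distrib if_distribR cong: if_cong)
  show "x * 1 = x"
  proof (transfer, simp only: clifford_pairs_eq, rule vec_eq_iff [THEN iffD2], rule allI)
    fix x :: "(real, 'a set) vec" and C :: "'a set"
    have "sym_diff A C = {} \<longleftrightarrow> A = C" for A
      by blast
    then show "(\<chi> C. \<Sum>A\<in>UNIV. clifford_sign A (sym_diff A C) * x $ A *
        axis {} 1 $ (sym_diff A C)) $ C = x $ C"
      by (simp add: axis_def if_distrib if_distribR cong: if_cong)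
  qed
  show "(x + y) * z = x * z + y * z" "x * (y + z) = x * y + x * z"
    by (transfer, simp add: vec_eq_iff clifford_pairs_eq algebra_simps sum.distrib)+
  show "r *\<^sub>R x * y = r *\<^sub>R (x * y)" "x * r *\<^sub>R y = r *\<^sub>R (x * y)"
    by (transfer, simp add: vec_eq_iff clifford_pairs_eq sum_distrib_left mult_ac)+
  show "(0 :: 'a clifford) \<noteq> 1"
    by transfer (simp add: vec_eq_iff axis_def)
qed

end

lift_definition clifford_blade :: "'n::finite set \<Rightarrow> 'n clifford" is "\<lambda>A. axis A 1" .

definition clifford_gen :: "'n::finite \<Rightarrow> 'n clifford" where
  "clifford_gen i = clifford_blade {i}"

lemma Basis_clifford_eq: "(Basis :: ('n::finite) clifford set) = range clifford_blade"
  by transfer (auto simp: Basis_vec_def)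

lemma clifford_blade_empty: "clifford_blade {} = 1"
  by transfer simp

lemma clifford_blade_mult:
  "clifford_blade A * clifford_blade B = clifford_sign A B *\<^sub>R clifford_blade (sym_diff A B)"
proof (transfer, simp only: clifford_pairs_eq, rule vec_eq_iff [THEN iffD2], rule allI)
  fix A B C :: "'a set"
  have eq: "B = sym_diff A C \<longleftrightarrow> C = sym_diff A B"
    by blast
  have "(\<chi> C. \<Sum>P\<in>UNIV. clifford_sign P (sym_diff P C) * axis A 1 $ P *
      axis B 1 $ (sym_diff P C)) $ C =
      (\<Sum>P\<in>UNIV. if P = A then clifford_sign A (sym_diff A C) * axis B 1 $ (sym_diff A C) else 0)"
    by (simp only: vec_lambda_beta, intro sum.cong refl) (simp add: axis_def)
  also have "\<dots> = clifford_sign A (sym_diff A C) * axis B 1 $ (sym_diff A C)"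
    by simp
  also have "\<dots> = (clifford_sign A B *\<^sub>R axis (sym_diff A B) 1) $ C"
    using eq by (simp only: axis_def vec_lambda_beta vector_scaleR_component) (simp, metis)
  finally show "(\<chi> C. \<Sum>P\<in>UNIV. clifford_sign P (sym_diff P C) * axis A 1 $ P *
      axis B 1 $ (sym_diff P C)) $ C = (clifford_sign A B *\<^sub>R axis (sym_diff A B) 1) $ C" .
qed

lemma clifford_blade_insert_less:
  assumes "\<And>a. a \<in> A \<Longrightarrow> i < a"
  shows "clifford_blade (insert i A) = clifford_gen i * clifford_blade A"
proof -
  have "{(a, b). a \<in> {i} \<and> b \<in> A \<and> b \<le> a} = {}"
    using assms by force
  then have "clifford_sign {i} A = 1"
    unfolding clifford_sign_def by (metis card.empty power_0)
  moreover have "sym_diff {i} A = insert i A"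
    using assms by force
  ultimately show ?thesis
    by (simp only: clifford_gen_def clifford_blade_mult scaleR_one)
qed

lemma clifford_gen_anticommute:
  "clifford_gen i * clifford_gen j + clifford_gen j * clifford_gen i = (if i = j then - 2 else 0)"
proof -
  have card: "{(a, b). a \<in> {i} \<and> b \<in> {j} \<and> b \<le> a} = (if j \<le> i then {(i, j)} else {})" for i j :: 'a
    by auto
  have sign: "clifford_sign {i} {j} = (if j \<le> i then - 1 else 1)" for i j :: 'a
    unfolding clifford_sign_def card by simp
  have comm: "sym_diff {i} {j} = sym_diff {j} {i}"
    by blast
  show ?thesis
  proof (cases "i = j")
    case True
    then show ?thesis
      unfolding clifford_gen_def clifford_blade_mult sign
      by (simp add: clifford_blade_empty)
  next
    case False
    then have "clifford_sign {i} {j} + clifford_sign {j} {i} = 0"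
      unfolding sign by auto
    then show ?thesis
      unfolding clifford_gen_def clifford_blade_mult comm
      using False by (simp flip: scaleR_left_distrib)
  qed
qed

text \<open>
  The identification of \<open>v\<close> with $\sum_j v_j e_j$.  A point of $\mathbb{R}^{n+1}$ is a pair
  $(x_0, \underline{x})$.
\<close>

type_synonym 'n paravector = "real \<times> (real ^ 'n)"

definition clifford_vec :: "real ^ 'n \<Rightarrow> ('n::finite) clifford" where
  "clifford_vec v = (\<Sum>i\<in>UNIV. v $ i *\<^sub>R clifford_gen i)"

section \<open>Differential operators\<close>

definition partial :: "'a \<Rightarrow> ('a::real_normed_vector \<Rightarrow> 'b::real_normed_vector) \<Rightarrow> 'a \<Rightarrow> 'b" where
  "partial b f x = vector_derivative (\<lambda>t. f (x + t *\<^sub>R b)) (at 0)"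

text \<open>Intended for open sets \<open>U\<close> only.\<close>

primrec C_class :: "nat \<Rightarrow> ('a::euclidean_space \<Rightarrow> 'b::real_normed_vector) \<Rightarrow> 'a set \<Rightarrow> bool" where
  "C_class 0 f U \<longleftrightarrow> continuous_on U f"
| "C_class (Suc k) f U \<longleftrightarrow> f differentiable_on U \<and> (\<forall>b\<in>Basis. C_class k (partial b f) U)"

abbreviation partial_0 :: "(('n::finite) paravector \<Rightarrow> 'b) \<Rightarrow> 'n paravector \<Rightarrow> 'b::real_normed_vector" where
  "partial_0 \<equiv> partial (1, 0)"

abbreviation partial_vec ::
  "'n \<Rightarrow> (('n::finite) paravector \<Rightarrow> 'b) \<Rightarrow> 'n paravector \<Rightarrow> 'b::real_normed_vector" where
  "partial_vec i \<equiv> partial (0, axis i 1)"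

type_synonym 'n clifford_fun = "'n paravector \<Rightarrow> 'n clifford"

definition dirac_left :: "('n::{finite,linorder}) clifford_fun \<Rightarrow> 'n clifford_fun" where
  "dirac_left f x = partial_0 f x + (\<Sum>i\<in>UNIV. clifford_gen i * partial_vec i f x)"

definition dirac_bar_left :: "('n::{finite,linorder}) clifford_fun \<Rightarrow> 'n clifford_fun" where
  "dirac_bar_left f x = partial_0 f x - (\<Sum>i\<in>UNIV. clifford_gen i * partial_vec i f x)"

definition dirac_right :: "('n::{finite,linorder}) clifford_fun \<Rightarrow> 'n clifford_fun" where
  "dirac_right f x = partial_0 f x + (\<Sum>i\<in>UNIV. partial_vec i f x * clifford_gen i)"

definition dirac_bar_right :: "('n::{finite,linorder}) clifford_fun \<Rightarrow> 'n clifford_fun" where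
  "dirac_bar_right f x = partial_0 f x - (\<Sum>i\<in>UNIV. partial_vec i f x * clifford_gen i)"

definition laplacian :: "('n::finite) clifford_fun \<Rightarrow> 'n clifford_fun" where
  "laplacian f x =
     partial_0 (partial_0 f) x + (\<Sum>i\<in>UNIV. partial_vec i (partial_vec i f) x)"

section \<open>Axial symmetry and slice hyperholomorphic functions\<close>

text \<open>The set $\mathbb{S}$ is \<open>sphere 0 1 :: (real ^ 'n) set\<close>.\<close>

definition axial_class :: "('n::finite) paravector \<Rightarrow> 'n paravector set" where
  "axial_class x = {(fst x, norm (snd x) *\<^sub>R I) | I. I \<in> sphere 0 1}"

definition axially_symmetric :: "('n::finite) paravector set \<Rightarrow> bool" where
  "axially_symmetric U \<longleftrightarrow> (\<forall>x\<in>U. axial_class x \<subseteq> U)"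

definition slice_domain :: "('n::finite) paravector set \<Rightarrow> (real \<times> real) set" where
  "slice_domain U = {(u, v). \<forall>I\<in>sphere 0 1. (u, v *\<^sub>R I) \<in> U}"

definition even_odd_pair ::
  "(real \<times> real \<Rightarrow> 'b) \<Rightarrow> (real \<times> real \<Rightarrow> 'b::real_vector) \<Rightarrow> (real \<times> real) set \<Rightarrow> bool" where
  "even_odd_pair \<alpha> \<beta> W \<longleftrightarrow> (\<forall>(u, v)\<in>W. \<alpha> (u, - v) = \<alpha> (u, v) \<and> \<beta> (u, - v) = - \<beta> (u, v))"

definition cauchy_riemann_pair ::
  "(real \<times> real \<Rightarrow> 'b) \<Rightarrow> (real \<times> real \<Rightarrow> 'b::real_normed_vector) \<Rightarrow> (real \<times> real) set \<Rightarrow> bool" where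
  "cauchy_riemann_pair \<alpha> \<beta> W \<longleftrightarrow>
     (\<forall>p\<in>W. partial (1, 0) \<alpha> p = partial (0, 1) \<beta> p \<and> partial (0, 1) \<alpha> p = - partial (1, 0) \<beta> p)"

definition left_slice_hyperholomorphic ::
  "('n::{finite,linorder}) clifford_fun \<Rightarrow> 'n paravector set \<Rightarrow> bool" where
  "left_slice_hyperholomorphic f U \<longleftrightarrow>
     (\<exists>\<alpha> \<beta>. \<alpha> differentiable_on slice_domain U \<and> \<beta> differentiable_on slice_domain U \<and>
        even_odd_pair \<alpha> \<beta> (slice_domain U) \<and> cauchy_riemann_pair \<alpha> \<beta> (slice_domain U) \<and>
        (\<forall>(u, v)\<in>slice_domain U. \<forall>I\<in>sphere 0 1.
           f (u, v *\<^sub>R I) = \<alpha> (u, v) + clifford_vec I * \<beta> (u, v)))"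

definition right_slice_hyperholomorphic ::
  "('n::{finite,linorder}) clifford_fun \<Rightarrow> 'n paravector set \<Rightarrow> bool" where
  "right_slice_hyperholomorphic f U \<longleftrightarrow>
     (\<exists>\<alpha> \<beta>. \<alpha> differentiable_on slice_domain U \<and> \<beta> differentiable_on slice_domain U \<and>
        even_odd_pair \<alpha> \<beta> (slice_domain U) \<and> cauchy_riemann_pair \<alpha> \<beta> (slice_domain U) \<and>
        (\<forall>(u, v)\<in>slice_domain U. \<forall>I\<in>sphere 0 1.
           f (u, v *\<^sub>R I) = \<alpha> (u, v) + \<beta> (u, v) * clifford_vec I))"

section \<open>Axially polyanalytic holomorphic Cliffordian functions\<close>

text \<open>
  For $\underline{x} = 0$ the quotient below is \<open>0\<close>; this choice does not matter, since
  $B(x_0, 0) = 0$ as \<open>B\<close> is odd.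
\<close>

definition left_axial_form ::
  "('n::{finite,linorder}) clifford_fun \<Rightarrow> 'n paravector set \<Rightarrow> bool" where
  "left_axial_form g U \<longleftrightarrow>
     (\<exists>A B. even_odd_pair A B (slice_domain U) \<and>
        (\<forall>(x0, x)\<in>U. g (x0, x) =
           A (x0, norm x) + clifford_vec (x /\<^sub>R norm x) * B (x0, norm x)))"

definition right_axial_form ::
  "('n::{finite,linorder}) clifford_fun \<Rightarrow> 'n paravector set \<Rightarrow> bool" where
  "right_axial_form g U \<longleftrightarrow>
     (\<exists>A B. even_odd_pair A B (slice_domain U) \<and>
        (\<forall>(x0, x)\<in>U. g (x0, x) =
           A (x0, norm x) + B (x0, norm x) * clifford_vec (x /\<^sub>R norm x)))"

definition left_axially_polyanalytic_cliffordian ::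
  "nat \<Rightarrow> nat \<Rightarrow> ('n::{finite,linorder}) clifford_fun \<Rightarrow> 'n paravector set \<Rightarrow> bool" where
  "left_axially_polyanalytic_cliffordian k m g U \<longleftrightarrow>
     C_class (2 * k + m) g U \<and>
     (\<forall>x\<in>U. (laplacian ^^ k) ((dirac_left ^^ m) g) x = 0) \<and>
     left_axial_form g U"

text \<open>Operators acting from the right are applied in the order in which they are written.\<close>

definition right_axially_polyanalytic_cliffordian ::
  "nat \<Rightarrow> nat \<Rightarrow> ('n::{finite,linorder}) clifford_fun \<Rightarrow> 'n paravector set \<Rightarrow> bool" where
  "right_axially_polyanalytic_cliffordian k m g U \<longleftrightarrow>
     C_class (2 * k + m) g U \<and>
     (\<forall>x\<in>U. (dirac_right ^^ m) ((laplacian ^^ k) g) x = 0) \<and>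
     right_axial_form g U"

end

theory Submission
  imports Defs "HOL-Complex_Analysis.Cauchy_Integral_Formula"
begin

text \<open>
  Write a slice hyperholomorphic function as $f(x) = \alpha(x_0, |\underline x|) + \underline x\,
  b(x_0, |\underline x|)$ with $b = \beta / v$.  Both $\alpha$ and $b$ are smooth and even in $v$; near the
  real axis this is $b(u, v) = \int_0^1 \partial_v \beta(u, t v)\,dt$.  The operator
  $\tau = v^{-1} \partial_v$ preserves smooth even functions, and
  $\partial_{x_i} \varphi(x_0, |\underline x|) = x_i\, (\tau \varphi)(x_0, |\underline x|)$,
  so $f$ is smooth on all of $U$ and the axial form is stable under $D$ and $\overline D$.

  The Cauchy--Riemann equations give $D f = (1 - n)\, b$ and
  $\partial_u^2 b + 3 \tau b + v^2 \tau^2 b = 0$.  If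
  $\partial_u^2 \varphi + r \tau \varphi + v^2 \tau^2 \varphi = 0$, then
  $\Delta_{n+1} \varphi = (n - r)\, \tau \varphi$, and $\tau \varphi$ satisfies the same equation with
  $r + 2$ in place of $r$.  Starting at $r = 3$, the factor $n - r$ vanishes at the $h_n$-th step, so
  $\Delta_{n+1}^{h_n} D f = 0$.  Since $D$, $\overline D$ and $\Delta_{n+1} = D \overline D$ commute on smooth
  functions, $\Delta_{n+1}^{\ell+1} D^{h_n-s-\ell} D^s \overline D^{\,h_n-\ell-1} f = \Delta_{n+1}^{h_n} D f$.
\<close>

section \<open>Smooth functions\<close>

text \<open>Two obstacles shape the proof. The pair \<open>\<alpha>\<close>, \<open>\<beta>\<close>
  is only assumed once differentiable; paired with a fixed vector it becomes the real and imaginary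
  part of a holomorphic function, and all higher derivatives come from there. The real axis is
  singular for both |x| and x/|x|; all functions are therefore written with even coefficients, and
  identities for \<tau> are checked after multiplication by v, the axis being reached by continuity.
  As to the constants: in 1 - n, the 1 is the term b of the v-derivative of v b, and n counts the
  squares e_i^2 = -1. The rule \<tau>(v^2 \<psi>) = 2 \<psi> + v^2 \<tau> \<psi> gives both 3 = 1 +
  2 and the increment of r by 2. As to the exponents: D^(h-s-l) D^s has exactly one D more than
  Dbar^(h-l-1). The pairs make up Delta^(h-l-1), which completes Delta^(l+1) to Delta^h, and the
  surplus D is the one that turns f into a multiple of b.\<close>

definition C_infinity :: "('a::euclidean_space \<Rightarrow> 'b::real_normed_vector) \<Rightarrow> 'a set \<Rightarrow> bool" where
  "C_infinity f U \<longleftrightarrow> (\<forall>k. C_class k f U)"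

lemma has_derivative_imp_line:
  assumes "(f has_derivative f') (at x)"
  shows "((\<lambda>t. f (x + t *\<^sub>R b)) has_vector_derivative f' b) (at 0)"
proof -
  interpret f': bounded_linear f'
    using assms by (rule has_derivative_bounded_linear)
  have "((\<lambda>t. x + t *\<^sub>R b) has_derivative (\<lambda>t. t *\<^sub>R b)) (at 0)"
    by (auto intro!: derivative_eq_intros)
  moreover have "(f has_derivative f') (at (x + 0 *\<^sub>R b))"
    using assms by simp
  ultimately have "((\<lambda>t. f (x + t *\<^sub>R b)) has_derivative (\<lambda>t. f' (t *\<^sub>R b))) (at 0)"
    by (rule has_derivative_compose)
  then show ?thesis
    by (simp add: has_vector_derivative_def f'.scaleR)
qed

lemma partial_eq_derivative:
  "(f has_derivative f') (at x) \<Longrightarrow> partial b f x = f' b"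
  unfolding partial_def by (rule vector_derivative_at) (rule has_derivative_imp_line)

text \<open>Functions are total, but the identities between them hold on open sets only. They can
  still be differentiated, because the line through \<open>x\<close> stays in \<open>U\<close> for
  small \<open>t\<close>.\<close>

lemma partial_cong:
  assumes "open U" "x \<in> U" "\<And>y. y \<in> U \<Longrightarrow> f y = g y"
  shows "partial b f x = partial b g x"
proof -
  have "((\<lambda>t. x + t *\<^sub>R b) \<longlongrightarrow> x + 0 *\<^sub>R b) (at 0)"
    by (intro tendsto_intros)
  then have "((\<lambda>t::real. x + t *\<^sub>R b) \<longlongrightarrow> x) (at 0)"
    by simp
  then have "\<forall>\<^sub>F t in at 0. x + t *\<^sub>R b \<in> U"
    using assms(1,2) by (rule topological_tendstoD)
  then have "\<forall>\<^sub>F t in nhds 0. x + t *\<^sub>R b \<in> U"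
    using assms(2) by (simp add: eventually_nhds_conv_at)
  then have ev: "\<forall>\<^sub>F t in nhds 0. f (x + t *\<^sub>R b) = g (x + t *\<^sub>R b)"
    by eventually_elim (rule assms(3))
  show ?thesis
    unfolding partial_def
    by (rule vector_derivative_cong_eq) (use ev in \<open>auto elim: eventually_mono\<close>)
qed

lemma differentiable_on_cong_open:
  assumes "open U" "\<And>y. y \<in> U \<Longrightarrow> f y = g y"
  shows "f differentiable_on U \<longleftrightarrow> g differentiable_on U"
proof -
  have "f differentiable_on U \<Longrightarrow> g differentiable_on U"
    if "\<And>y. y \<in> U \<Longrightarrow> f y = g y" for f g :: "'a \<Rightarrow> 'b"
    using that has_derivative_transform[of _ U g f]
    unfolding differentiable_on_def differentiable_def by metis
  from this[of f g] this[of g f] show ?thesis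
    using assms(2) by auto
qed

lemma partial_add:
  assumes "f differentiable (at x)" "g differentiable (at x)"
  shows "partial b (\<lambda>x. f x + g x) x = partial b f x + partial b g x"
proof -
  have f: "(f has_derivative frechet_derivative f (at x)) (at x)"
    "(g has_derivative frechet_derivative g (at x)) (at x)"
    using assms by (simp_all add: frechet_derivative_works)
  show ?thesis
    using partial_eq_derivative[OF has_derivative_add[OF f]]
      partial_eq_derivative[OF f(1)] partial_eq_derivative[OF f(2)] by simp
qed

lemma partial_bounded_linear:
  assumes "bounded_linear T" "f differentiable (at x)"
  shows "partial b (\<lambda>x. T (f x)) x = T (partial b f x)"
proof -
  have f: "(f has_derivative frechet_derivative f (at x)) (at x)"
    using assms(2) by (simp add: frechet_derivative_works)
  show ?thesis
    using partial_eq_derivative[OF bounded_linear.has_derivative[OF assms(1) f]]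
      partial_eq_derivative[OF f] by simp
qed

lemma partial_bilinear:
  assumes "bounded_bilinear mul" "f differentiable (at x)" "g differentiable (at x)"
  shows "partial b (\<lambda>x. mul (f x) (g x)) x = mul (f x) (partial b g x) + mul (partial b f x) (g x)"
proof -
  have f: "(f has_derivative frechet_derivative f (at x)) (at x)"
    "(g has_derivative frechet_derivative g (at x)) (at x)"
    using assms(2,3) by (simp_all add: frechet_derivative_works)
  show ?thesis
    using partial_eq_derivative[OF bounded_bilinear.FDERIV[OF assms(1) f]]
      partial_eq_derivative[OF f(1)] partial_eq_derivative[OF f(2)] by simp
qed

lemma C_class_cong:
  assumes "open U" "\<And>x. x \<in> U \<Longrightarrow> f x = g x"
  shows "C_class k f U \<longleftrightarrow> C_class k g U"
  using assms(2)
proof (induction k arbitrary: f g)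
  case 0
  then show ?case
    by (auto intro!: continuous_on_cong)
next
  case (Suc k)
  have "C_class k (partial b f) U \<longleftrightarrow> C_class k (partial b g) U" for b
    by (rule Suc.IH) (rule partial_cong[OF assms(1) _ Suc.prems])
  moreover have "f differentiable_on U \<longleftrightarrow> g differentiable_on U"
    using differentiable_on_cong_open[OF assms(1) Suc.prems] .
  ultimately show ?case
    by simp
qed

lemma C_class_SucD: "C_class (Suc k) f U \<Longrightarrow> C_class k f U"
  by (induction k arbitrary: f) (auto intro: differentiable_imp_continuous_on)

lemma C_class_imp_continuous_on: "C_class k f U \<Longrightarrow> continuous_on U f"
  by (cases k) (auto intro: differentiable_imp_continuous_on)

text \<open>Needed where a function is smooth by one formula near the axis and by another away from
  it.\<close>

lemma C_class_local:
  assumes "open U" "\<And>x. x \<in> U \<Longrightarrow> \<exists>V. open V \<and> x \<in> V \<and> V \<subseteq> U \<and> C_class k f V"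
  shows "C_class k f U"
  using assms(2)
proof (induction k arbitrary: f)
  case 0
  have "isCont f x" if "x \<in> U" for x
    using 0[OF that] by (auto simp: continuous_on_eq_continuous_at)
  then show ?case
    by (simp add: continuous_at_imp_continuous_on)
next
  case (Suc k)
  have "f differentiable at x" if "x \<in> U" for x
    using Suc.prems[OF that] by (auto simp: differentiable_on_eq_differentiable_at)
  then have "f differentiable_on U"
    by (simp add: differentiable_on_eq_differentiable_at assms(1))
  moreover have "C_class k (partial b f) U" if "b \<in> Basis" for b
  proof (rule Suc.IH)
    show "\<exists>V. open V \<and> x \<in> V \<and> V \<subseteq> U \<and> C_class k (partial b f) V" if "x \<in> U" for x
      using Suc.prems[OF that] \<open>b \<in> Basis\<close> unfolding C_class.simps by blast
  qed
  ultimately show ?case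
    by simp
qed

lemma C_class_subset:
  assumes "V \<subseteq> U" "C_class k f U"
  shows "C_class k f V"
  using assms(2)
proof (induction k arbitrary: f)
  case 0
  then show ?case
    using assms(1) continuous_on_subset by auto
next
  case (Suc k)
  then show ?case
    using assms(1) differentiable_on_subset by auto
qed

lemma C_infinity_cong:
  "open U \<Longrightarrow> (\<And>x. x \<in> U \<Longrightarrow> f x = g x) \<Longrightarrow> C_infinity f U \<longleftrightarrow> C_infinity g U"
  unfolding C_infinity_def using C_class_cong by blast

lemma C_infinity_subset: "C_infinity f U \<Longrightarrow> V \<subseteq> U \<Longrightarrow> C_infinity f V"
  unfolding C_infinity_def using C_class_subset by blast

lemma C_infinity_local:
  assumes "open U" "\<And>x. x \<in> U \<Longrightarrow> \<exists>V. open V \<and> x \<in> V \<and> V \<subseteq> U \<and> C_infinity f V"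
  shows "C_infinity f U"
  unfolding C_infinity_def
proof
  fix k
  show "C_class k f U"
    by (rule C_class_local[OF assms(1)]) (metis assms(2) C_infinity_def)
qed

lemma C_infinity_partial: "C_infinity f U \<Longrightarrow> b \<in> Basis \<Longrightarrow> C_infinity (partial b f) U"
  unfolding C_infinity_def by (metis C_class.simps(2))

lemma C_infinity_differentiable: "C_infinity f U \<Longrightarrow> open U \<Longrightarrow> x \<in> U \<Longrightarrow> f differentiable (at x)"
  unfolding C_infinity_def by (metis C_class.simps(2) differentiable_on_eq_differentiable_at)

lemma C_infinity_has_partial_line:
  assumes "C_infinity f U" "open U" "x + t *\<^sub>R b \<in> U"
  shows "((\<lambda>t. f (x + t *\<^sub>R b)) has_vector_derivative partial b f (x + t *\<^sub>R b)) (at t)"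
proof -
  have d: "(f has_derivative frechet_derivative f (at (x + t *\<^sub>R b))) (at (x + t *\<^sub>R b))"
    using C_infinity_differentiable[OF assms] by (simp add: frechet_derivative_works)
  interpret D: bounded_linear "frechet_derivative f (at (x + t *\<^sub>R b))"
    using d by (rule has_derivative_bounded_linear)
  have "((\<lambda>t. x + t *\<^sub>R b) has_derivative (\<lambda>t. t *\<^sub>R b)) (at t)"
    by (auto intro!: derivative_eq_intros)
  from has_derivative_compose[OF this d] show ?thesis
    by (simp add: has_vector_derivative_def D.scaleR partial_eq_derivative[OF d])
qed

lemma C_infinity_has_partial:
  assumes "C_infinity f U" "open U" "x \<in> U"
  shows "((\<lambda>t. f (x + t *\<^sub>R b)) has_vector_derivative partial b f x) (at 0)"
  using C_infinity_has_partial_line[of f U x 0 b] assms by simp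

lemma C_infinity_continuous: "C_infinity f U \<Longrightarrow> continuous_on U f"
  unfolding C_infinity_def using C_class_imp_continuous_on by blast

lemma partial_const [simp]: "partial b (\<lambda>x. c) = (\<lambda>x. 0)"
  by (auto simp: partial_def)

lemma C_class_const [simp]: "C_class k (\<lambda>x. c) U"
  by (induction k arbitrary: c) auto

lemma C_infinity_const [simp]: "C_infinity (\<lambda>x. c) U"
  by (simp add: C_infinity_def)

lemma C_class_bounded_linear:
  assumes "open U" "bounded_linear T" "C_class k f U"
  shows "C_class k (\<lambda>x. T (f x)) U"
  using assms(3)
proof (induction k arbitrary: f)
  case 0
  then show ?case
    using bounded_linear.continuous_on[OF assms(2)] by auto
next
  case (Suc k)
  have d: "f differentiable (at x)" if "x \<in> U" for x
    using Suc.prems that assms(1) by (simp add: differentiable_on_eq_differentiable_at)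
  have "(\<lambda>x. T (f x)) differentiable (at x)" if "x \<in> U" for x
    using d[OF that] bounded_linear.has_derivative[OF assms(2)]
    unfolding differentiable_def by blast
  moreover have "C_class k (partial b (\<lambda>x. T (f x))) U" if "b \<in> Basis" for b
    using Suc.IH[of "partial b f"] Suc.prems that
    by (subst C_class_cong[OF assms(1) partial_bounded_linear[OF assms(2) d]]) auto
  ultimately show ?case
    by (simp add: differentiable_on_eq_differentiable_at assms(1))
qed

lemma C_class_add:
  assumes "open U" "C_class k f U" "C_class k g U"
  shows "C_class k (\<lambda>x. f x + g x) U"
  using assms(2,3)
proof (induction k arbitrary: f g)
  case 0
  then show ?case
    by (auto intro: continuous_intros)
next
  case (Suc k)
  have d: "f differentiable (at x)" "g differentiable (at x)" if "x \<in> U" for x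
    using Suc.prems that assms(1) by (simp_all add: differentiable_on_eq_differentiable_at)
  have "C_class k (partial b (\<lambda>x. f x + g x)) U" if "b \<in> Basis" for b
    using Suc.IH[of "partial b f" "partial b g"] Suc.prems that
    by (subst C_class_cong[OF assms(1) partial_add[OF d]]) auto
  with Suc.prems show ?case
    by simp
qed

text \<open>Stated for an arbitrary bilinear map so that scaling, real products and the action of
  vectors on the Clifford algebra are covered at once.\<close>

lemma C_class_bilinear:
  assumes "open U" "bounded_bilinear mul" "C_class k f U" "C_class k g U"
  shows "C_class k (\<lambda>x. mul (f x) (g x)) U"
  using assms(3,4)
proof (induction k arbitrary: f g)
  case 0
  then show ?case
    using bounded_bilinear.continuous_on[OF assms(2)] by auto
next
  case (Suc k)
  have d: "f differentiable (at x)" "g differentiable (at x)" if "x \<in> U" for x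
    using Suc.prems that assms(1) by (simp_all add: differentiable_on_eq_differentiable_at)
  \<comment> \<open>Each summand of the Leibniz rule keeps one factor undifferentiated, so the
    induction hypothesis also has to apply to \<open>f\<close> and \<open>g\<close>
    themselves.\<close>
  have k: "C_class k f U" "C_class k g U"
    using Suc.prems by (auto intro: C_class_SucD simp del: C_class.simps)
  have "(\<lambda>x. mul (f x) (g x)) differentiable (at x)" if "x \<in> U" for x
    using d[OF that] bounded_bilinear.FDERIV[OF assms(2)]
    unfolding differentiable_def by blast
  moreover have "C_class k (partial b (\<lambda>x. mul (f x) (g x))) U" if "b \<in> Basis" for b
  proof (subst C_class_cong[OF assms(1) partial_bilinear[OF assms(2)]])
    show "C_class k (\<lambda>x. mul (f x) (partial b g x) + mul (partial b f x) (g x)) U"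
      using Suc.prems that k by (intro C_class_add[OF assms(1)] Suc.IH) auto
  qed (use d in auto)
  ultimately show ?case
    by (simp add: differentiable_on_eq_differentiable_at assms(1))
qed

lemma C_infinity_bounded_linear:
  "open U \<Longrightarrow> bounded_linear T \<Longrightarrow> C_infinity f U \<Longrightarrow> C_infinity (\<lambda>x. T (f x)) U"
  by (simp add: C_infinity_def C_class_bounded_linear)

lemma C_infinity_add:
  "open U \<Longrightarrow> C_infinity f U \<Longrightarrow> C_infinity g U \<Longrightarrow> C_infinity (\<lambda>x. f x + g x) U"
  by (simp add: C_infinity_def C_class_add)

lemma C_infinity_bilinear:
  "open U \<Longrightarrow> bounded_bilinear mul \<Longrightarrow> C_infinity f U \<Longrightarrow> C_infinity g U \<Longrightarrow>
    C_infinity (\<lambda>x. mul (f x) (g x)) U"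
  by (simp add: C_infinity_def C_class_bilinear)

lemmas C_infinity_scaleR = C_infinity_bilinear[OF _ bounded_bilinear_scaleR]

lemma C_infinity_sum:
  "open U \<Longrightarrow> (\<And>i. i \<in> I \<Longrightarrow> C_infinity (f i) U) \<Longrightarrow> C_infinity (\<lambda>x. \<Sum>i\<in>I. f i x) U"
  by (induction I rule: infinite_finite_induct) (auto intro!: C_infinity_add)

lemma C_infinity_linear:
  assumes "bounded_linear T"
  shows "C_infinity T U"
  unfolding C_infinity_def
proof
  fix k
  have "partial b T = (\<lambda>x. T b)" for b
    using partial_eq_derivative[OF bounded_linear_imp_has_derivative[OF assms]] by (rule ext)
  then have "T differentiable_on U \<and> (\<forall>b\<in>Basis. C_class k (partial b T) U)"
    using bounded_linear_imp_differentiable_on[OF assms] by simp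
  then show "C_class k T U"
    by (cases k) (auto intro: C_class_SucD differentiable_imp_continuous_on)
qed

lemma differentiable_sum':
  "(\<And>i. i \<in> I \<Longrightarrow> f i differentiable (at x)) \<Longrightarrow> (\<lambda>x. \<Sum>i\<in>I. f i x) differentiable (at x)"
  by (induction I rule: infinite_finite_induct) auto

lemma partial_sum:
  "(\<And>i. i \<in> I \<Longrightarrow> f i differentiable (at x)) \<Longrightarrow>
    partial b (\<lambda>x. \<Sum>i\<in>I. f i x) x = (\<Sum>i\<in>I. partial b (f i) x)"
  by (induction I rule: infinite_finite_induct) (auto simp: partial_add differentiable_sum')

text \<open>\<open>C_class\<close> fixes no order of differentiation, so Schwarz's theorem is a
  separate fact. Both sides turn out to be the derivative at \<open>t = 0\<close> of the single
  function \<open>partial b f (x + t *\<^sub>R c) - partial b f x\<close>, and a vector derivative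
  is unique.\<close>

lemma partial_commute:
  fixes f :: "'a::euclidean_space \<Rightarrow> 'b::euclidean_space"
  assumes f: "C_infinity f U" and "open U" "x \<in> U" and bc: "b \<in> Basis" "c \<in> Basis"
  shows "partial b (partial c f) x = partial c (partial b f) x"
proof -
  obtain e where e: "e > 0" "ball x e \<subseteq> U"
    using assms(2,3) openE by blast
  \<comment> \<open>Two displacements of length at most e/3 along unit vectors stay strictly inside
    the ball of radius e.\<close>
  define r where "r = e / 3"
  have "r > 0"
    using e(1) by (simp add: r_def)
  have U: "x + s *\<^sub>R b + t *\<^sub>R c \<in> U" if "\<bar>s\<bar> \<le> r" "\<bar>t\<bar> \<le> r" for s t
  proof -
    have "norm (s *\<^sub>R b + t *\<^sub>R c) \<le> norm (s *\<^sub>R b) + norm (t *\<^sub>R c)"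
      by (rule norm_triangle_ineq)
    also have "\<dots> < e"
      using that bc e(1) by (simp add: r_def)
    finally have "x + s *\<^sub>R b + t *\<^sub>R c \<in> ball x e"
      by (simp add: dist_norm algebra_simps flip: norm_minus_commute)
    then show ?thesis
      using e(2) by blast
  qed
  have fb: "C_infinity (partial b f) U" and fc: "C_infinity (partial c f) U"
    and fbc: "C_infinity (partial b (partial c f)) U"
    using f bc by (auto intro!: C_infinity_partial)
  \<comment> \<open>differentiate the fundamental theorem of calculus along \<open>c\<close> under the integral, along \<open>b\<close>\<close>
  have diff: "partial b f (x + t *\<^sub>R c) - partial b f x =
      integral {0..t} (\<lambda>\<tau>. partial b (partial c f) (x + \<tau> *\<^sub>R c))" if t: "t \<in> {0..r}" for t
  proof -
    have I: "((\<lambda>\<tau>. partial c f (x + s *\<^sub>R b + \<tau> *\<^sub>R c)) has_integral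
        f (x + s *\<^sub>R b + t *\<^sub>R c) - f (x + s *\<^sub>R b)) {0..t}" if s: "s \<in> {-r..r}" for s
    proof -
      have "((\<lambda>\<tau>. partial c f (x + s *\<^sub>R b + \<tau> *\<^sub>R c)) has_integral
        f (x + s *\<^sub>R b + t *\<^sub>R c) - f (x + s *\<^sub>R b + 0 *\<^sub>R c)) {0..t}"
      proof (rule fundamental_theorem_of_calculus[where f = "\<lambda>\<tau>. f (x + s *\<^sub>R b + \<tau> *\<^sub>R c)"])
        show "0 \<le> t"
          using t by simp
        fix \<tau> assume "\<tau> \<in> {0..t}"
        then have "x + s *\<^sub>R b + \<tau> *\<^sub>R c \<in> U"
          using s t by (intro U) auto
        then show "((\<lambda>\<tau>. f (x + s *\<^sub>R b + \<tau> *\<^sub>R c)) has_vector_derivative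
            partial c f (x + s *\<^sub>R b + \<tau> *\<^sub>R c)) (at \<tau> within {0..t})"
          by (rule has_vector_derivative_at_within[OF C_infinity_has_partial_line[OF f \<open>open U\<close>]])
      qed
      then show ?thesis
        by simp
    qed
    have "((\<lambda>s. integral (cbox 0 t) (\<lambda>\<tau>. partial c f (x + s *\<^sub>R b + \<tau> *\<^sub>R c))) has_vector_derivative
        integral (cbox 0 t) (\<lambda>\<tau>. partial b (partial c f) (x + 0 *\<^sub>R b + \<tau> *\<^sub>R c))) (at 0 within {-r..r})"
    proof (rule leibniz_rule_vector_derivative)
      fix s \<tau> assume st: "s \<in> {-r..r}" "\<tau> \<in> cbox 0 t"
      have "((\<lambda>s. partial c f (x + \<tau> *\<^sub>R c + s *\<^sub>R b)) has_vector_derivative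
          partial b (partial c f) (x + \<tau> *\<^sub>R c + s *\<^sub>R b)) (at s within {-r..r})"
      proof (rule has_vector_derivative_at_within[OF C_infinity_has_partial_line[OF fc \<open>open U\<close>]])
        show "x + \<tau> *\<^sub>R c + s *\<^sub>R b \<in> U"
          using U[of s \<tau>] st t by (auto simp: add_ac)
      qed
      then show "((\<lambda>s. partial c f (x + s *\<^sub>R b + \<tau> *\<^sub>R c)) has_vector_derivative
          partial b (partial c f) (x + s *\<^sub>R b + \<tau> *\<^sub>R c)) (at s within {-r..r})"
        by (simp add: add_ac)
    next
      show "continuous_on ({-r..r} \<times> cbox 0 t)
          (\<lambda>(s, \<tau>). partial b (partial c f) (x + s *\<^sub>R b + \<tau> *\<^sub>R c))"
        unfolding case_prod_beta
      proof (rule continuous_on_compose2[OF C_infinity_continuous[OF fbc]])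
        show "(\<lambda>p. x + fst p *\<^sub>R b + snd p *\<^sub>R c) ` ({-r..r} \<times> cbox 0 t) \<subseteq> U"
          using U t by auto
      qed (intro continuous_intros)
    qed (use I \<open>r > 0\<close> in auto)
    then have "((\<lambda>s. f (x + s *\<^sub>R b + t *\<^sub>R c) - f (x + s *\<^sub>R b)) has_vector_derivative
        integral {0..t} (\<lambda>\<tau>. partial b (partial c f) (x + \<tau> *\<^sub>R c))) (at 0 within {-r..r})"
      using \<open>r > 0\<close>
      by (intro has_vector_derivative_transform[of 0 "{-r..r}"
            "\<lambda>s. f (x + s *\<^sub>R b + t *\<^sub>R c) - f (x + s *\<^sub>R b)"
            "\<lambda>s. integral (cbox 0 t) (\<lambda>\<tau>. partial c f (x + s *\<^sub>R b + \<tau> *\<^sub>R c))"])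
        (auto simp: integral_unique[OF I])
    moreover have "((\<lambda>s. f (x + s *\<^sub>R b + t *\<^sub>R c) - f (x + s *\<^sub>R b)) has_vector_derivative
        partial b f (x + t *\<^sub>R c) - partial b f x) (at 0 within {-r..r})"
    proof -
      have "((\<lambda>s. f (x + t *\<^sub>R c + s *\<^sub>R b)) has_vector_derivative
          partial b f (x + t *\<^sub>R c)) (at 0)"
      proof (rule C_infinity_has_partial[OF f \<open>open U\<close>])
        show "x + t *\<^sub>R c \<in> U"
          using U[of 0 t] t \<open>r > 0\<close> by simp
      qed
      then have "((\<lambda>s. f (x + s *\<^sub>R b + t *\<^sub>R c)) has_vector_derivative
          partial b f (x + t *\<^sub>R c)) (at 0)"
        by (simp add: add_ac)
      from has_vector_derivative_diff[OF this C_infinity_has_partial[OF f \<open>open U\<close> \<open>x \<in> U\<close>]]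
      show ?thesis
        by (rule has_vector_derivative_at_within)
    qed
    ultimately show ?thesis
      using \<open>r > 0\<close> by (intro vector_derivative_unique_within_closed_interval[of "-r" r 0]) auto
  qed
  have cont: "continuous_on {0..r} (\<lambda>\<tau>. partial b (partial c f) (x + \<tau> *\<^sub>R c))"
  proof (rule continuous_on_compose2[OF C_infinity_continuous[OF fbc]])
    show "(\<lambda>\<tau>. x + \<tau> *\<^sub>R c) ` {0..r} \<subseteq> U"
      using U[of 0] \<open>r > 0\<close> by auto
  qed (intro continuous_intros)
  \<comment> \<open>The derivative in \<open>t\<close> is one-sided, because the integral formula is
    only available for \<open>t\<close> in \<open>{0..r}\<close>; uniqueness holds on a
    nondegenerate interval, endpoints included.\<close>
  have "((\<lambda>t. integral {0..t} (\<lambda>\<tau>. partial b (partial c f) (x + \<tau> *\<^sub>R c))) has_vector_derivative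
      partial b (partial c f) (x + 0 *\<^sub>R c)) (at 0 within {0..r})"
    using \<open>r > 0\<close> by (intro integral_has_vector_derivative[OF cont]) auto
  then have "((\<lambda>t. partial b f (x + t *\<^sub>R c) - partial b f x) has_vector_derivative
      partial b (partial c f) x) (at 0 within {0..r})"
    using \<open>r > 0\<close>
    by (intro has_vector_derivative_transform[of 0 "{0..r}"
          "\<lambda>t. partial b f (x + t *\<^sub>R c) - partial b f x"
          "\<lambda>t. integral {0..t} (\<lambda>\<tau>. partial b (partial c f) (x + \<tau> *\<^sub>R c))"])
      (auto simp: diff)
  moreover have "((\<lambda>t. partial b f (x + t *\<^sub>R c) - partial b f x) has_vector_derivative
      partial c (partial b f) x - 0) (at 0 within {0..r})"
    by (rule has_vector_derivative_at_within[OF has_vector_derivative_diff[OF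
        C_infinity_has_partial[OF fb \<open>open U\<close> \<open>x \<in> U\<close>] has_vector_derivative_const]])
  ultimately show ?thesis
    using \<open>r > 0\<close> by (intro vector_derivative_unique_within_closed_interval[of 0 r 0]) auto
qed

section \<open>Functions in the plane\<close>

lemma has_derivative_plane:
  fixes f :: "real \<times> real \<Rightarrow> 'b::real_normed_vector"
  assumes "f differentiable (at p)"
  shows "(f has_derivative (\<lambda>h. fst h *\<^sub>R partial (1, 0) f p + snd h *\<^sub>R partial (0, 1) f p)) (at p)"
proof -
  have d: "(f has_derivative frechet_derivative f (at p)) (at p)"
    using assms by (simp add: frechet_derivative_works)
  interpret D: bounded_linear "frechet_derivative f (at p)"
    using d by (rule has_derivative_bounded_linear)
  have "frechet_derivative f (at p) h = fst h *\<^sub>R partial (1, 0) f p + snd h *\<^sub>R partial (0, 1) f p" for h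
  proof -
    have "h = fst h *\<^sub>R (1, 0) + snd h *\<^sub>R (0, 1)"
      by (simp add: prod_eq_iff)
    then have "frechet_derivative f (at p) h = frechet_derivative f (at p) (fst h *\<^sub>R (1, 0) + snd h *\<^sub>R (0, 1))"
      by simp
    also have "\<dots> = fst h *\<^sub>R partial (1, 0) f p + snd h *\<^sub>R partial (0, 1) f p"
      by (simp only: D.add D.scaleR partial_eq_derivative[OF d])
    finally show ?thesis .
  qed
  then have "frechet_derivative f (at p) = (\<lambda>h. fst h *\<^sub>R partial (1, 0) f p + snd h *\<^sub>R partial (0, 1) f p)" ..
  with d show ?thesis
    by (rule back_subst[of "\<lambda>d. (f has_derivative d) (at p)"])
qed

lemma Basis_plane: "(Basis :: (real \<times> real) set) = {(1, 0), (0, 1)}"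
  by (auto simp: Basis_prod_def)

text \<open>An average of \<open>f\<close> over the segment from (u, 0) to (u, v). Differentiating
  in v brings out a factor \<open>t\<close>; the weight \<open>t ^ k\<close> makes the family over
  all \<open>k\<close> closed under both partial derivatives.\<close>

definition radial_integral :: "nat \<Rightarrow> (real \<times> real \<Rightarrow> 'b::euclidean_space) \<Rightarrow> real \<times> real \<Rightarrow> 'b" where
  "radial_integral k f p = integral (cbox 0 1) (\<lambda>t. t ^ k *\<^sub>R f (fst p, t * snd p))"

section \<open>Parameter integrals over vertical segments in a rectangle\<close>

context
  fixes X Y :: "real set" and W :: "(real \<times> real) set"
  assumes XY: "open X" "convex X" "open Y" "convex Y" "0 \<in> Y"
    and W: "W = X \<times> Y"
begin

lemma radial_segment: "p \<in> W \<Longrightarrow> t \<in> cbox 0 1 \<Longrightarrow> (fst p, t * snd p) \<in> W"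
  using convexD[OF XY(4,5), of "snd p" "1 - t" t] by (auto simp: W mem_Times_iff)

lemma continuous_on_radial_integrand:
  fixes f :: "real \<times> real \<Rightarrow> 'b::euclidean_space"
  assumes "continuous_on W f"
  shows "continuous_on (W \<times> cbox 0 1) (\<lambda>q. f (fst (fst q), snd q * snd (fst q)))"
  by (rule continuous_on_compose2[OF assms])
    (auto intro!: continuous_intros radial_segment)

text \<open>Differentiation under the integral sign. The segments stay in \<open>W\<close> because
  \<open>Y\<close> is convex and contains 0; convexity of all of \<open>W\<close> is what
  \<open>leibniz_rule\<close> asks of the parameter set.\<close>

lemma has_derivative_radial_integral:
  fixes f :: "real \<times> real \<Rightarrow> 'b::euclidean_space"
  assumes f: "C_infinity f W" and p: "p \<in> W"
  shows "(radial_integral k f has_derivative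
    (\<lambda>h. fst h *\<^sub>R radial_integral k (partial (1, 0) f) p +
      snd h *\<^sub>R radial_integral (Suc k) (partial (0, 1) f) p)) (at p)"
proof -
  have "open W" "convex W"
    using XY by (auto simp: W open_Times convex_Times)
  let ?u = "\<lambda>p t. partial (1, 0) f (fst p, t * snd p)"
  let ?v = "\<lambda>p t. partial (0, 1) f (fst p, t * snd p)"
  \<comment> \<open>\<open>leibniz_rule\<close> integrates the derivative as an operator-valued
    function, so the total derivative of the integrand is packaged as a bounded linear function;
    evaluating its integral at \<open>h\<close> then gives back the two scalar-weighted
    integrals.\<close>
  define D where "D p t = t ^ k *\<^sub>R (blinfun_scaleR_left (?u p t) o\<^sub>L fst_blinfun) +
    t ^ Suc k *\<^sub>R (blinfun_scaleR_left (?v p t) o\<^sub>L snd_blinfun)" for p t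
  have D_apply: "D p t h = fst h *\<^sub>R (t ^ k *\<^sub>R ?u p t) + snd h *\<^sub>R (t ^ Suc k *\<^sub>R ?v p t)" for p t h
    by (simp add: D_def blinfun.bilinear_simps mult_ac)
  have f': "C_infinity (partial (1, 0) f) W" "C_infinity (partial (0, 1) f) W"
    using f by (auto intro: C_infinity_partial simp: Basis_plane)
  note cont = continuous_on_radial_integrand[OF C_infinity_continuous[OF f]]
    continuous_on_radial_integrand[OF C_infinity_continuous[OF f'(1)]]
    continuous_on_radial_integrand[OF C_infinity_continuous[OF f'(2)]]
  have cont_t: "continuous_on (cbox 0 1) (\<lambda>t. g (fst p, t * snd p))"
    if "p \<in> W" "C_infinity g W" for p and g :: "real \<times> real \<Rightarrow> 'b"
    using C_infinity_continuous[OF that(2)]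
    by (rule continuous_on_compose2) (use that(1) in \<open>auto intro!: continuous_intros radial_segment\<close>)
  have cont_D: "continuous_on (W \<times> cbox 0 1) (\<lambda>(p, t). D p t)"
    unfolding D_def case_prod_beta
    by (intro continuous_intros bounded_linear.continuous_on[OF bounded_linear_blinfun_scaleR_left] cont(2,3))
  have "((\<lambda>p. integral (cbox 0 1) (\<lambda>t. t ^ k *\<^sub>R f (fst p, t * snd p))) has_derivative
      blinfun_apply (integral (cbox 0 1) (D p))) (at p within W)"
  proof (rule leibniz_rule[OF _ _ cont_D p \<open>convex W\<close>])
    fix q t assume q: "q \<in> W" and t: "t \<in> cbox (0::real) 1"
    have "(f has_derivative (\<lambda>h. fst h *\<^sub>R ?u q t + snd h *\<^sub>R ?v q t)) (at (fst q, t * snd q))"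
      by (intro has_derivative_plane C_infinity_differentiable[OF f \<open>open W\<close>] radial_segment q t)
    moreover have "((\<lambda>q. (fst q, t * snd q)) has_derivative (\<lambda>h. (fst h, t * snd h))) (at q)"
      by (auto intro!: derivative_eq_intros)
    ultimately have "((\<lambda>q. f (fst q, t * snd q)) has_derivative
        (\<lambda>h. fst h *\<^sub>R ?u q t + (t * snd h) *\<^sub>R ?v q t)) (at q)"
      using has_derivative_compose[of "\<lambda>q. (fst q, t * snd q)" _ q UNIV f] by fastforce
    then have "((\<lambda>q. t ^ k *\<^sub>R f (fst q, t * snd q)) has_derivative
        (\<lambda>h. t ^ k *\<^sub>R (fst h *\<^sub>R ?u q t + (t * snd h) *\<^sub>R ?v q t))) (at q)"
      by (rule has_derivative_scaleR_right)
    also have "(\<lambda>h. t ^ k *\<^sub>R (fst h *\<^sub>R ?u q t + (t * snd h) *\<^sub>R ?v q t)) = blinfun_apply (D q t)"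
      by (auto simp: D_apply algebra_simps)
    finally show "((\<lambda>q. t ^ k *\<^sub>R f (fst q, t * snd q)) has_derivative blinfun_apply (D q t)) (at q within W)"
      by (rule has_derivative_at_withinI)
  next
    fix q assume "q \<in> W"
    then show "(\<lambda>t. t ^ k *\<^sub>R f (fst q, t * snd q)) integrable_on cbox 0 1"
      by (intro integrable_continuous continuous_intros cont_t f)
  qed
  moreover have "blinfun_apply (integral (cbox 0 1) (D p)) = (\<lambda>h. fst h *\<^sub>R radial_integral k (partial (1, 0) f) p +
      snd h *\<^sub>R radial_integral (Suc k) (partial (0, 1) f) p)"
  proof
    fix h
    have "continuous_on (cbox 0 1) (\<lambda>t. D p t)"
      unfolding D_def
      by (intro continuous_intros bounded_linear.continuous_on[OF bounded_linear_blinfun_scaleR_left] cont_t f' p)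
    then have "blinfun_apply (integral (cbox 0 1) (D p)) h = integral (cbox 0 1) (\<lambda>t. D p t h)"
      by (intro blinfun_apply_integral integrable_continuous)
    also have "\<dots> = integral (cbox 0 1) (\<lambda>t. fst h *\<^sub>R (t ^ k *\<^sub>R ?u p t)) +
        integral (cbox 0 1) (\<lambda>t. snd h *\<^sub>R (t ^ Suc k *\<^sub>R ?v p t))"
      unfolding D_apply
      by (rule integral_add) (intro integrable_continuous continuous_intros cont_t f' p)+
    also have "\<dots> = fst h *\<^sub>R radial_integral k (partial (1, 0) f) p +
        snd h *\<^sub>R radial_integral (Suc k) (partial (0, 1) f) p"
      unfolding radial_integral_def by (simp only: integral_cmul)
    finally show "blinfun_apply (integral (cbox 0 1) (D p)) h = \<dots>" .
  qed
  ultimately show ?thesis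
    by (simp only: radial_integral_def[abs_def] at_within_open[OF p \<open>open W\<close>])
qed

lemma C_infinity_radial_integral:
  fixes f :: "real \<times> real \<Rightarrow> 'b::euclidean_space"
  assumes "C_infinity f W"
  shows "C_infinity (radial_integral k f) W"
proof -
  have "open W"
    using XY by (auto simp: W open_Times)
  have "C_class m (radial_integral k f) W" for m
    using assms
  proof (induction m arbitrary: f k)
    case 0
    then show ?case
      using has_derivative_continuous[OF has_derivative_radial_integral[OF 0]]
      by (auto intro: continuous_at_imp_continuous_on)
  next
    case (Suc m)
    note d = has_derivative_radial_integral[OF Suc.prems]
    have "partial (1, 0) (radial_integral k f) p = radial_integral k (partial (1, 0) f) p"
      "partial (0, 1) (radial_integral k f) p = radial_integral (Suc k) (partial (0, 1) f) p"
      if "p \<in> W" for p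
      using partial_eq_derivative[OF d[OF that]] by simp_all
    then have "C_class m (partial b (radial_integral k f)) W \<longleftrightarrow>
        C_class m (radial_integral (if b = (1, 0) then k else Suc k) (partial b f)) W"
      if "b \<in> Basis" for b
      using that by (intro C_class_cong[OF \<open>open W\<close>]) (auto simp: Basis_plane)
    then have "C_class m (partial b (radial_integral k f)) W" if "b \<in> Basis" for b
      using Suc.IH[OF C_infinity_partial[OF Suc.prems]] that by simp
    moreover have "radial_integral k f differentiable_on W"
      using d by (auto simp: differentiable_on_eq_differentiable_at \<open>open W\<close> differentiable_def)
    ultimately show ?case
      by (simp add: Basis_plane)
  qed
  then show ?thesis
    by (simp add: C_infinity_def)
qed

end

section \<open>Smoothness of Cauchy--Riemann pairs\<close>

lemma cauchy_riemann_has_field_derivative: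
  fixes a b :: "real \<times> real \<Rightarrow> real"
  assumes "a differentiable (at (Re z, Im z))" "b differentiable (at (Re z, Im z))"
    and "partial (1, 0) a (Re z, Im z) = partial (0, 1) b (Re z, Im z)"
    and "partial (0, 1) a (Re z, Im z) = - partial (1, 0) b (Re z, Im z)"
  shows "((\<lambda>z. Complex (a (Re z, Im z)) (b (Re z, Im z))) has_field_derivative
    Complex (partial (1, 0) a (Re z, Im z)) (partial (1, 0) b (Re z, Im z))) (at z)"
proof -
  have L: "((\<lambda>z. (Re z, Im z)) has_derivative (\<lambda>h. (Re h, Im h))) (at z)"
    by (auto intro!: derivative_eq_intros)
  have a: "((\<lambda>z. a (Re z, Im z)) has_derivative
      (\<lambda>h. Re h *\<^sub>R partial (1, 0) a (Re z, Im z) + Im h *\<^sub>R partial (0, 1) a (Re z, Im z))) (at z)"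
    and b: "((\<lambda>z. b (Re z, Im z)) has_derivative
      (\<lambda>h. Re h *\<^sub>R partial (1, 0) b (Re z, Im z) + Im h *\<^sub>R partial (0, 1) b (Re z, Im z))) (at z)"
    using has_derivative_compose[OF L has_derivative_plane[OF assms(1)]]
      has_derivative_compose[OF L has_derivative_plane[OF assms(2)]] by simp_all
  have "((\<lambda>z. a (Re z, Im z) *\<^sub>R 1 + b (Re z, Im z) *\<^sub>R \<i>) has_derivative
      (\<lambda>h. (Re h *\<^sub>R partial (1, 0) a (Re z, Im z) + Im h *\<^sub>R partial (0, 1) a (Re z, Im z)) *\<^sub>R 1 +
        (Re h *\<^sub>R partial (1, 0) b (Re z, Im z) + Im h *\<^sub>R partial (0, 1) b (Re z, Im z)) *\<^sub>R \<i>)) (at z)"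
    by (intro has_derivative_add has_derivative_scaleR_left a b)
  then show ?thesis
    unfolding has_field_derivative_def
    by (rule has_derivative_eq_rhs[THEN has_derivative_transform[of z UNIV, rotated 2]])
      (auto simp: complex_eq_iff assms(3,4) algebra_simps)
qed

text \<open>The partial derivatives of Re g are Re g' and Re (i g'), again real parts of holomorphic
  functions. Hence the induction generalises over \<open>g\<close>.\<close>

lemma C_infinity_Re_holomorphic:
  assumes "open S" "g holomorphic_on S"
  shows "C_infinity (\<lambda>p. Re (g (Complex (fst p) (snd p)))) {p. Complex (fst p) (snd p) \<in> S}"
proof -
  let ?V = "{p. Complex (fst p) (snd p) \<in> S}"
  have L: "bounded_linear (\<lambda>p. Complex (fst p) (snd p))"
    by (rule linear_conv_bounded_linear[THEN iffD1], rule linearI) (auto simp: complex_eq_iff)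
  have "open ((\<lambda>p. Complex (fst p) (snd p)) -` S)"
    using bounded_linear.continuous_on[OF L continuous_on_id]
    by (intro open_vimage \<open>open S\<close>) simp_all
  then have V: "open ?V"
    by (simp add: vimage_def)
  have "C_class k (\<lambda>p. Re (g (Complex (fst p) (snd p)))) ?V" for k
    using assms(2)
  proof (induction k arbitrary: g)
    case 0
    have "continuous_on ?V (\<lambda>p. g (Complex (fst p) (snd p)))"
      by (rule continuous_on_compose2[OF holomorphic_on_imp_continuous_on[OF 0]])
        (auto intro: bounded_linear.continuous_on[OF L continuous_on_id])
    then show ?case
      by (auto intro: continuous_intros)
  next
    case (Suc k)
    have d: "((\<lambda>p. Re (g (Complex (fst p) (snd p)))) has_derivative
        (\<lambda>h. Re (deriv g (Complex (fst p) (snd p)) * Complex (fst h) (snd h)))) (at p)" if "p \<in> ?V" for p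
    proof -
      have "(g has_derivative (*) (deriv g (Complex (fst p) (snd p)))) (at (Complex (fst p) (snd p)))"
        using holomorphic_derivI[OF Suc.prems assms(1)] that
        by (simp add: has_field_derivative_def)
      from has_derivative_compose[OF bounded_linear_imp_has_derivative[OF L] this]
      show ?thesis
        by (rule has_derivative_Re)
    qed
    have h: "deriv g holomorphic_on S" "(\<lambda>z. deriv g z * \<i>) holomorphic_on S"
      by (intro holomorphic_intros Suc.prems assms(1))+
    have eq: "partial (1, 0) (\<lambda>p. Re (g (Complex (fst p) (snd p)))) p = Re (deriv g (Complex (fst p) (snd p)))"
      "partial (0, 1) (\<lambda>p. Re (g (Complex (fst p) (snd p)))) p = Re (deriv g (Complex (fst p) (snd p)) * \<i>)"
      if "p \<in> ?V" for p
      using partial_eq_derivative[OF d[OF that]] by (simp_all add: complex_eq_iff)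
    then have "C_class k (partial (1, 0) (\<lambda>p. Re (g (Complex (fst p) (snd p))))) ?V"
      "C_class k (partial (0, 1) (\<lambda>p. Re (g (Complex (fst p) (snd p))))) ?V"
      using Suc.IH[OF h(1)] Suc.IH[OF h(2)] C_class_cong[OF V eq(1)] C_class_cong[OF V eq(2)]
      by simp_all
    moreover have "(\<lambda>p. Re (g (Complex (fst p) (snd p)))) differentiable_on ?V"
      using V differentiableI[OF d] by (simp add: differentiable_on_eq_differentiable_at)
    ultimately show ?case
      by (simp add: Basis_plane)
  qed
  then show ?thesis
    by (simp add: C_infinity_def)
qed

text \<open>For each fixed vector \<open>e\<close>, the inner products of \<open>\<alpha>\<close>
  and \<open>\<beta>\<close> with \<open>e\<close> satisfy the scalar Cauchy-Riemann equations and
  combine into a holomorphic function. Finitely many basis vectors \<open>e\<close> recover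
  \<open>\<alpha>\<close> and \<open>\<beta>\<close>.\<close>

lemma cauchy_riemann_pair_C_infinity:
  fixes \<alpha> \<beta> :: "real \<times> real \<Rightarrow> 'b::euclidean_space"
  assumes W: "open W" and "\<alpha> differentiable_on W" "\<beta> differentiable_on W"
    and "cauchy_riemann_pair \<alpha> \<beta> W"
  shows "C_infinity \<alpha> W" "C_infinity \<beta> W"
proof -
  let ?S = "(\<lambda>z. (Re z, Im z)) -` W"
  have S: "open ?S"
    by (intro open_vimage W continuous_intros)
  have SW: "{p. Complex (fst p) (snd p) \<in> ?S} = W"
    by auto
  have d: "\<alpha> differentiable (at p)" "\<beta> differentiable (at p)" if "p \<in> W" for p
    using assms that by (auto simp: differentiable_on_eq_differentiable_at)
  have inner: "(\<lambda>p. \<gamma> p \<bullet> e) differentiable (at p)" "partial b (\<lambda>p. \<gamma> p \<bullet> e) p = partial b \<gamma> p \<bullet> e"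
    if "\<gamma> differentiable (at p)" for \<gamma> :: "real \<times> real \<Rightarrow> 'b" and e p b
    using that bounded_linear.has_derivative[OF bounded_linear_inner_left]
      partial_bounded_linear[OF bounded_linear_inner_left that]
    unfolding differentiable_def by blast+
  have C: "C_infinity (\<lambda>p. \<alpha> p \<bullet> e) W \<and> C_infinity (\<lambda>p. \<beta> p \<bullet> e) W" for e
  proof
    let ?F = "\<lambda>z. Complex (\<alpha> (Re z, Im z) \<bullet> e) (\<beta> (Re z, Im z) \<bullet> e)"
    have "(?F has_field_derivative Complex (partial (1, 0) (\<lambda>p. \<alpha> p \<bullet> e) (Re z, Im z))
        (partial (1, 0) (\<lambda>p. \<beta> p \<bullet> e) (Re z, Im z))) (at z)" if "z \<in> ?S" for z
    proof -
      have z: "(Re z, Im z) \<in> W"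
        using that by simp
      show ?thesis
        using assms(4) z
        by (intro cauchy_riemann_has_field_derivative inner d)
          (simp_all add: inner(2)[OF d(1)[OF z]] inner(2)[OF d(2)[OF z]] cauchy_riemann_pair_def)
    qed
    then have F: "?F holomorphic_on ?S"
      using S holomorphic_on_open by blast
    show "C_infinity (\<lambda>p. \<alpha> p \<bullet> e) W"
      using C_infinity_Re_holomorphic[OF S F] unfolding SW by simp
    \<comment> \<open>The imaginary part of \<open>?F z\<close> is the real part of
      \<open>- \<i> * ?F z\<close>.\<close>
    have "(\<lambda>z. - \<i> * ?F z) holomorphic_on ?S"
      by (intro holomorphic_intros F)
    from C_infinity_Re_holomorphic[OF S this] show "C_infinity (\<lambda>p. \<beta> p \<bullet> e) W"
      unfolding SW by simp
  qed
  have "C_infinity \<gamma> W" if "\<And>e. C_infinity (\<lambda>p. \<gamma> p \<bullet> e) W" for \<gamma> :: "real \<times> real \<Rightarrow> 'b"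
  proof -
    have "C_infinity (\<lambda>p. \<Sum>e\<in>Basis. (\<gamma> p \<bullet> e) *\<^sub>R e) W"
      by (intro C_infinity_sum W C_infinity_scaleR that C_infinity_const)
    then show ?thesis
      by (simp add: euclidean_representation)
  qed
  with C show "C_infinity \<alpha> W" "C_infinity \<beta> W"
    by blast+
qed

section \<open>Even functions and the operator \<open>v\<^sup>-\<^sup>1 \<partial>\<^sub>v\<close>\<close>

text \<open>
  The value on the axis \<open>v = 0\<close> makes the quotient of a smooth odd function smooth.
\<close>

definition odd_quotient :: "(real \<times> real \<Rightarrow> 'b) \<Rightarrow> real \<times> real \<Rightarrow> 'b::real_normed_vector" where
  "odd_quotient \<eta> p = (if snd p = 0 then partial (0, 1) \<eta> p else \<eta> p /\<^sub>R snd p)"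

text \<open>The operator \<tau>. On the axis its value is the second derivative in v.\<close>

definition axial_deriv :: "(real \<times> real \<Rightarrow> 'b) \<Rightarrow> real \<times> real \<Rightarrow> 'b::real_normed_vector" where
  "axial_deriv \<phi> = odd_quotient (partial (0, 1) \<phi>)"

text \<open>The induction closes because the derivative of 1/v is minus the square of 1/v: the
  induction hypothesis and the product rule suffice.\<close>

lemma C_infinity_inverse_snd: "C_infinity (\<lambda>p. inverse (snd p)) {p :: real \<times> real. snd p \<noteq> 0}"
proof -
  let ?V = "{p :: real \<times> real. snd p \<noteq> 0}"
  have V: "open ?V"
    by (intro open_Collect_neq continuous_intros)
  have d: "((\<lambda>p. inverse (snd p)) has_derivative (\<lambda>h. - (inverse (snd p) * snd h * inverse (snd p)))) (at p)"
    if "p \<in> ?V" for p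
    using that by (auto intro!: derivative_eq_intros)
  have "C_class k (\<lambda>p. inverse (snd p)) ?V" for k
  proof (induction k)
    case 0
    then show ?case
      by (auto intro!: continuous_intros)
  next
    case (Suc k)
    have sq: "C_class k (\<lambda>p. - (inverse (snd p) * inverse (snd p))) ?V"
      by (rule C_class_bounded_linear[OF V bounded_linear_minus[OF bounded_linear_ident]])
        (intro C_class_bilinear[OF V bounded_bilinear_mult] Suc)
    have eq: "partial (1, 0) (\<lambda>p. inverse (snd p)) p = 0"
      "partial (0, 1) (\<lambda>p. inverse (snd p)) p = - (inverse (snd p) * inverse (snd p))"
      if "p \<in> ?V" for p :: "real \<times> real"
      using partial_eq_derivative[OF d[OF that]] by simp_all
    have "C_class k (partial (1, 0) (\<lambda>p. inverse (snd p))) ?V"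
      using C_class_cong[OF V eq(1)] by simp
    moreover have "C_class k (partial (0, 1) (\<lambda>p. inverse (snd p))) ?V"
      using C_class_cong[OF V eq(2)] sq by simp
    moreover have "(\<lambda>p. inverse (snd p)) differentiable_on ?V"
      using V differentiableI[OF d] by (simp add: differentiable_on_eq_differentiable_at)
    ultimately show ?case
      by (simp add: Basis_plane)
  qed
  then show ?thesis
    by (simp add: C_infinity_def)
qed

locale reflection_domain =
  fixes W :: "(real \<times> real) set"
  assumes open_domain: "open W"
    and reflect: "(u, v) \<in> W \<Longrightarrow> (u, - v) \<in> W"
begin

definition smooth_even :: "(real \<times> real \<Rightarrow> 'b::euclidean_space) \<Rightarrow> bool" where
  "smooth_even \<phi> \<longleftrightarrow> C_infinity \<phi> W \<and> (\<forall>(u, v)\<in>W. \<phi> (u, - v) = \<phi> (u, v))"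

lemma smooth_evenD:
  assumes "smooth_even \<phi>"
  shows "C_infinity \<phi> W" "(u, v) \<in> W \<Longrightarrow> \<phi> (u, - v) = \<phi> (u, v)"
  using assms by (auto simp: smooth_even_def)

lemma smooth_even_differentiable: "smooth_even \<phi> \<Longrightarrow> p \<in> W \<Longrightarrow> \<phi> differentiable (at p)"
  using C_infinity_differentiable[OF smooth_evenD(1) open_domain] .

lemma odd_quotient_times:
  assumes "\<And>u v. (u, v) \<in> W \<Longrightarrow> \<eta> (u, - v) = - \<eta> (u, v)" "p \<in> W"
  shows "\<eta> p = snd p *\<^sub>R odd_quotient \<eta> p"
proof (cases "snd p = 0")
  case True
  \<comment> \<open>On the axis the reflection fixes \<open>p\<close>, so oddness forces the value
    0.\<close>
  then have "\<eta> p = - \<eta> p"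
    using assms(1)[of "fst p" "snd p"] assms(2) by (metis add.inverse_neutral prod.collapse)
  then have "2 *\<^sub>R \<eta> p = 0"
    by (metis add.right_inverse scaleR_2)
  with True show ?thesis
    by simp
qed (simp add: odd_quotient_def)

text \<open>Hadamard's lemma. Off the axis the quotient is a product with 1/v. Near the axis,
  integrating the derivative of t -> \<open>\<eta>\<close> (u, t v) over [0, 1] and using
  \<open>\<eta>\<close> (u, 0) = 0 exhibits it as a \<open>radial_integral\<close>, which is smooth
  across v = 0.\<close>

lemma smooth_even_odd_quotient:
  assumes \<eta>: "C_infinity \<eta> W" and odd: "\<And>u v. (u, v) \<in> W \<Longrightarrow> \<eta> (u, - v) = - \<eta> (u, v)"
  shows "smooth_even (odd_quotient \<eta>)"
  unfolding smooth_even_def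
proof
  show "\<forall>(u, v)\<in>W. odd_quotient \<eta> (u, - v) = odd_quotient \<eta> (u, v)"
    using odd by (auto simp: odd_quotient_def)
  show "C_infinity (odd_quotient \<eta>) W"
  proof (rule C_infinity_local[OF open_domain])
    fix p assume p: "p \<in> W"
    show "\<exists>V. open V \<and> p \<in> V \<and> V \<subseteq> W \<and> C_infinity (odd_quotient \<eta>) V"
    proof (cases "snd p = 0")
      case False
      let ?V = "W \<inter> {p. snd p \<noteq> 0}"
      have V: "open ?V"
        by (intro open_Int open_domain open_Collect_neq continuous_intros)
      have "C_infinity (\<lambda>p. inverse (snd p) *\<^sub>R \<eta> p) ?V"
        by (intro C_infinity_scaleR V C_infinity_subset[OF \<eta>] C_infinity_subset[OF C_infinity_inverse_snd]) auto
      then have "C_infinity (odd_quotient \<eta>) ?V"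
        by (subst C_infinity_cong[OF V]) (auto simp: odd_quotient_def)
      with V False p show ?thesis
        by blast
    next
      case True
      obtain A B where AB: "open A" "open B" "fst p \<in> A" "snd p \<in> B" "A \<times> B \<subseteq> W"
        using open_prod_elim[OF open_domain p] by (metis mem_Times_iff)
      obtain e where e: "e > 0" "ball (fst p) e \<subseteq> A"
        using AB(1,3) openE by blast
      obtain d where d: "d > 0" "ball (snd p) d \<subseteq> B"
        using AB(2,4) openE by blast
      \<comment> \<open>A box centred on the axis, so that every vertical segment down to the axis
        stays inside.\<close>
      let ?V = "ball (fst p) e \<times> ball (0::real) d"
      have V: "open ?V" "?V \<subseteq> W"
        using e d AB(5) True by (auto simp: open_Times)
      note xy = open_ball convex_ball open_ball convex_ball centre_in_ball[THEN iffD2, OF \<open>d > 0\<close>] refl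
      have \<eta>V: "C_infinity \<eta> ?V"
        using C_infinity_subset[OF \<eta> V(2)] .
      then have \<eta>v: "C_infinity (partial (0, 1) \<eta>) ?V"
        by (rule C_infinity_partial) (simp add: Basis_plane)
      have "odd_quotient \<eta> q = radial_integral 0 (partial (0, 1) \<eta>) q" if q: "q \<in> ?V" for q
      proof (cases "snd q = 0")
        \<comment> \<open>Here the integrand is constant in \<open>t\<close>, and the integral
          equals the value chosen in \<open>odd_quotient\<close>.\<close>
        case True
        then show ?thesis
          by (cases q) (simp add: radial_integral_def odd_quotient_def)
      next
        case False
        have "((\<lambda>t. snd q *\<^sub>R partial (0, 1) \<eta> (fst q, t * snd q)) has_integral
            \<eta> (fst q, 1 * snd q) - \<eta> (fst q, 0 * snd q)) {0..1}"
        proof (rule fundamental_theorem_of_calculus[where f = "\<lambda>t. \<eta> (fst q, t * snd q)"])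
          fix t :: real assume t: "t \<in> {0..1}"
          have "(fst q, t * snd q) \<in> ?V"
            using radial_segment[OF xy q] t by auto
          then have outer: "(\<eta> has_derivative (\<lambda>h. fst h *\<^sub>R partial (1, 0) \<eta> (fst q, t * snd q) +
              snd h *\<^sub>R partial (0, 1) \<eta> (fst q, t * snd q))) (at (fst q, t * snd q))"
            by (intro has_derivative_plane C_infinity_differentiable[OF \<eta>V V(1)])
          have "((\<lambda>t. (fst q, t * snd q)) has_derivative (\<lambda>s. (0, s * snd q))) (at t)"
            by (auto intro!: derivative_eq_intros)
          from has_derivative_compose[OF this outer] have "((\<lambda>t. \<eta> (fst q, t * snd q)) has_derivative
              (\<lambda>s. (s * snd q) *\<^sub>R partial (0, 1) \<eta> (fst q, t * snd q))) (at t)"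
            by simp
          then show "((\<lambda>t. \<eta> (fst q, t * snd q)) has_vector_derivative
              snd q *\<^sub>R partial (0, 1) \<eta> (fst q, t * snd q)) (at t within {0..1})"
            by (simp add: has_vector_derivative_def has_derivative_at_withinI)
        qed simp
        moreover have "\<eta> (fst q, 0 * snd q) = 0"
        proof -
          have "(fst q, 0) \<in> W"
            using V(2) q \<open>d > 0\<close> by auto
          from odd_quotient_times[of \<eta>, OF odd this] show ?thesis
            by simp
        qed
        ultimately have "((\<lambda>t. snd q *\<^sub>R partial (0, 1) \<eta> (fst q, t * snd q)) has_integral \<eta> q) {0..1}"
          by simp
        from has_integral_cmul[OF this, of "inverse (snd q)"] False
        have "((\<lambda>t. partial (0, 1) \<eta> (fst q, t * snd q)) has_integral \<eta> q /\<^sub>R snd q) {0..1}"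
          by simp
        then show ?thesis
          using False by (simp add: radial_integral_def odd_quotient_def integral_unique)
      qed
      then have "C_infinity (odd_quotient \<eta>) ?V"
        using C_infinity_cong[OF V(1)] C_infinity_radial_integral[OF xy \<eta>v] by blast
      then show ?thesis
        using V e d True by (intro exI[of _ ?V]) (auto simp: mem_Times_iff)
    qed
  qed
qed

text \<open>Off the axis the factor v cancels. A point on the axis is a vertical limit of points of
  \<open>W\<close> with v nonzero, so continuity decides there.\<close>

lemma odd_quotient_unique:
  fixes \<psi>1 \<psi>2 :: "real \<times> real \<Rightarrow> 'b::euclidean_space"
  assumes "continuous_on W \<psi>1" "continuous_on W \<psi>2"
    and eq: "\<And>p. p \<in> W \<Longrightarrow> snd p *\<^sub>R \<psi>1 p = snd p *\<^sub>R \<psi>2 p" and p: "p \<in> W"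
  shows "\<psi>1 p = \<psi>2 p"
proof (cases "snd p = 0")
  case True
  have lim: "((\<lambda>t. p + t *\<^sub>R (0, 1)) \<longlongrightarrow> p) (at (0::real))"
  proof -
    have "((\<lambda>t. p + t *\<^sub>R (0, 1)) \<longlongrightarrow> p + 0 *\<^sub>R (0, 1)) (at (0::real))"
      by (intro tendsto_intros)
    then show ?thesis
      by (simp add: prod_eq_iff flip: zero_prod_def)
  qed
  have "\<forall>\<^sub>F t in at 0. p + t *\<^sub>R (0, 1) \<in> W"
    using lim open_domain p by (rule topological_tendstoD)
  moreover have "\<forall>\<^sub>F t in at (0::real). t \<noteq> 0"
    by (simp add: eventually_at_filter)
  ultimately have ev: "\<forall>\<^sub>F t in at 0. \<psi>1 (p + t *\<^sub>R (0, 1)) = \<psi>2 (p + t *\<^sub>R (0, 1))"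
  proof eventually_elim
    case (elim t)
    then show ?case
      using eq[of "p + t *\<^sub>R (0, 1)"] True by simp
  qed
  have l: "((\<lambda>t. \<psi> (p + t *\<^sub>R (0, 1))) \<longlongrightarrow> \<psi> p) (at 0)"
    if "continuous_on W \<psi>" for \<psi> :: "real \<times> real \<Rightarrow> 'b"
    using that p open_domain lim
    by (intro isCont_tendsto_compose[OF _ lim]) (auto simp: continuous_on_eq_continuous_at)
  have "((\<lambda>t. \<psi>2 (p + t *\<^sub>R (0, 1))) \<longlongrightarrow> \<psi>1 p) (at 0)"
    using Lim_transform_eventually[OF l[OF assms(1)] ev] .
  then show ?thesis
    using tendsto_unique[OF _ _ l[OF assms(2)]] by simp
qed (use eq[OF p] in simp)

text \<open>Both claims come from differentiating \<open>\<phi>\<close> composed with the reflection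
  v -> -v, which equals \<open>\<phi>\<close> on \<open>W\<close>.\<close>

lemma smooth_even_partial:
  assumes "smooth_even \<phi>"
  shows "smooth_even (partial (1, 0) \<phi>)"
    and "(u, v) \<in> W \<Longrightarrow> partial (0, 1) \<phi> (u, - v) = - partial (0, 1) \<phi> (u, v)"
proof -
  let ?R = "\<lambda>p. (fst p, - snd p) :: real \<times> real"
  have *: "partial (1, 0) \<phi> (u, - v) = partial (1, 0) \<phi> (u, v) \<and>
      partial (0, 1) \<phi> (u, - v) = - partial (0, 1) \<phi> (u, v)" if uv: "(u, v) \<in> W" for u v
  proof -
    have "(\<phi> has_derivative (\<lambda>h. fst h *\<^sub>R partial (1, 0) \<phi> (u, - v) + snd h *\<^sub>R partial (0, 1) \<phi> (u, - v)))
        (at (u, - v))"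
      using has_derivative_plane[OF smooth_even_differentiable[OF assms reflect[OF uv]]] .
    then have outer: "(\<phi> has_derivative (\<lambda>h. fst h *\<^sub>R partial (1, 0) \<phi> (u, - v) + snd h *\<^sub>R partial (0, 1) \<phi> (u, - v)))
        (at (?R (u, v)))"
      by simp
    have "(?R has_derivative ?R) (at (u, v))"
      by (auto intro!: derivative_eq_intros)
    from has_derivative_compose[OF this outer] have d: "((\<lambda>p. \<phi> (?R p)) has_derivative
        (\<lambda>h. fst h *\<^sub>R partial (1, 0) \<phi> (u, - v) + (- snd h) *\<^sub>R partial (0, 1) \<phi> (u, - v))) (at (u, v))"
      by simp
    have "partial b (\<lambda>p. \<phi> (?R p)) (u, v) = partial b \<phi> (u, v)" for b
      by (rule partial_cong[OF open_domain uv]) (use smooth_evenD(2)[OF assms] in force)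
    then show ?thesis
      using partial_eq_derivative[OF d, of "(1, 0)"] partial_eq_derivative[OF d, of "(0, 1)"] by simp
  qed
  then show "smooth_even (partial (1, 0) \<phi>)"
    using C_infinity_partial[OF smooth_evenD(1)[OF assms]]
    by (auto simp: smooth_even_def Basis_plane)
  show "partial (0, 1) \<phi> (u, - v) = - partial (0, 1) \<phi> (u, v)" if "(u, v) \<in> W"
    using * that by blast
qed

lemma smooth_even_axial_deriv:
  assumes "smooth_even \<phi>"
  shows "smooth_even (axial_deriv \<phi>)"
    and "p \<in> W \<Longrightarrow> partial (0, 1) \<phi> p = snd p *\<^sub>R axial_deriv \<phi> p"
proof -
  have "C_infinity (partial (0, 1) \<phi>) W"
    using C_infinity_partial[OF smooth_evenD(1)[OF assms]] by (simp add: Basis_plane)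
  with smooth_even_partial(2)[OF assms] show "smooth_even (axial_deriv \<phi>)"
    unfolding axial_deriv_def by (intro smooth_even_odd_quotient)
  show "p \<in> W \<Longrightarrow> partial (0, 1) \<phi> p = snd p *\<^sub>R axial_deriv \<phi> p"
    unfolding axial_deriv_def
    by (rule odd_quotient_times[of "partial (0, 1) \<phi>"]) (rule smooth_even_partial(2)[OF assms])
qed

text \<open>The tool behind the rules for \<tau>: it suffices to exhibit the v-derivative as v times
  a smooth even function, so no quotient is formed and the axis needs no separate case.\<close>

lemma axial_deriv_unique:
  assumes "smooth_even \<phi>" "smooth_even \<psi>" "p \<in> W"
    and "\<And>p. p \<in> W \<Longrightarrow> partial (0, 1) \<phi> p = snd p *\<^sub>R \<psi> p"
  shows "axial_deriv \<phi> p = \<psi> p"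
proof (rule odd_quotient_unique[OF _ _ _ assms(3)])
  show "continuous_on W (axial_deriv \<phi>)" "continuous_on W \<psi>"
    using smooth_even_axial_deriv(1)[OF assms(1)] assms(2)
    by (simp_all add: smooth_even_def C_infinity_continuous)
  show "snd p *\<^sub>R axial_deriv \<phi> p = snd p *\<^sub>R \<psi> p" if "p \<in> W" for p
    using smooth_even_axial_deriv(2)[OF assms(1) that] assms(4)[OF that] by metis
qed

lemma smooth_even_add: "smooth_even \<phi> \<Longrightarrow> smooth_even \<psi> \<Longrightarrow> smooth_even (\<lambda>p. \<phi> p + \<psi> p)"
proof -
  assume *: "smooth_even \<phi>" "smooth_even \<psi>"
  then have "C_infinity (\<lambda>p. \<phi> p + \<psi> p) W"
    unfolding smooth_even_def by (blast intro: C_infinity_add open_domain)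
  then show ?thesis
    using smooth_evenD(2)[OF *(1)] smooth_evenD(2)[OF *(2)] by (auto simp: smooth_even_def)
qed

lemma smooth_even_scaleR: "smooth_even \<phi> \<Longrightarrow> smooth_even (\<lambda>p. c *\<^sub>R \<phi> p)"
  unfolding smooth_even_def by (auto intro: C_infinity_scaleR open_domain)

lemma smooth_even_minus: "smooth_even \<phi> \<Longrightarrow> smooth_even (\<lambda>p. - \<phi> p)"
  using smooth_even_scaleR[of \<phi> "-1"] by simp

lemma smooth_even_diff: "smooth_even \<phi> \<Longrightarrow> smooth_even \<psi> \<Longrightarrow> smooth_even (\<lambda>p. \<phi> p - \<psi> p)"
  using smooth_even_add[OF _ smooth_even_minus, of \<phi> \<psi>] by simp

lemma smooth_even_square: "smooth_even \<phi> \<Longrightarrow> smooth_even (\<lambda>p. (snd p)\<^sup>2 *\<^sub>R \<phi> p)"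
  using C_infinity_scaleR[OF open_domain C_infinity_bilinear[OF open_domain bounded_bilinear_mult
        C_infinity_linear[OF bounded_linear_snd] C_infinity_linear[OF bounded_linear_snd]], of \<phi>]
  by (auto simp: smooth_even_def power2_eq_square)

lemmas smooth_even_intros = smooth_even_add smooth_even_scaleR smooth_even_minus smooth_even_diff
  smooth_even_square smooth_even_partial(1) smooth_even_axial_deriv(1)

section \<open>Calculus rules for \<tau>\<close>

lemma axial_deriv_cong:
  assumes "smooth_even \<phi>" "\<And>p. p \<in> W \<Longrightarrow> \<phi> p = \<psi> p" "p \<in> W"
  shows "axial_deriv \<phi> p = axial_deriv \<psi> p"
proof -
  have 1: "partial (0, 1) \<phi> p = partial (0, 1) \<psi> p" if "p \<in> W" for p
    using partial_cong[OF open_domain that assms(2)] .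
  \<comment> \<open>On the axis \<open>axial_deriv\<close> is a second derivative, so equality of
    the first derivatives on all of \<open>W\<close> is differentiated once more.\<close>
  then have "partial (0, 1) (partial (0, 1) \<phi>) p = partial (0, 1) (partial (0, 1) \<psi>) p"
    using partial_cong[OF open_domain assms(3)] by blast
  with 1[OF assms(3)] show ?thesis
    by (simp add: axial_deriv_def odd_quotient_def)
qed

lemma axial_deriv_add:
  assumes "smooth_even \<phi>" "smooth_even \<psi>" "p \<in> W"
  shows "axial_deriv (\<lambda>p. \<phi> p + \<psi> p) p = axial_deriv \<phi> p + axial_deriv \<psi> p"
  using assms
  by (intro axial_deriv_unique smooth_even_intros)
    (auto simp: partial_add smooth_even_differentiable smooth_even_axial_deriv(2) scaleR_add_right)

lemma axial_deriv_scaleR: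
  assumes "smooth_even \<phi>" "p \<in> W"
  shows "axial_deriv (\<lambda>p. c *\<^sub>R \<phi> p) p = c *\<^sub>R axial_deriv \<phi> p"
  using assms
  by (intro axial_deriv_unique smooth_even_intros)
    (auto simp: partial_bounded_linear[OF bounded_linear_scaleR_right]
      smooth_even_differentiable smooth_even_axial_deriv(2))

lemma partial_snd_scaleR:
  fixes \<phi> :: "real \<times> real \<Rightarrow> 'b::euclidean_space"
  assumes "smooth_even \<phi>" "p \<in> W"
  shows "partial (1, 0) (\<lambda>p. snd p *\<^sub>R \<phi> p) p = snd p *\<^sub>R partial (1, 0) \<phi> p"
    and "partial (0, 1) (\<lambda>p. snd p *\<^sub>R \<phi> p) p = \<phi> p + (snd p)\<^sup>2 *\<^sub>R axial_deriv \<phi> p"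
proof -
  have s: "(snd has_derivative snd) (at p)" for p :: "real \<times> real"
    by (rule bounded_linear_imp_has_derivative[OF bounded_linear_snd])
  then have "(snd :: real \<times> real \<Rightarrow> real) differentiable (at p)"
    by (rule differentiableI)
  note * = partial_bilinear[OF bounded_bilinear_scaleR this smooth_even_differentiable[OF assms]]
    partial_eq_derivative[OF s]
  show "partial (1, 0) (\<lambda>p. snd p *\<^sub>R \<phi> p) p = snd p *\<^sub>R partial (1, 0) \<phi> p"
    "partial (0, 1) (\<lambda>p. snd p *\<^sub>R \<phi> p) p = \<phi> p + (snd p)\<^sup>2 *\<^sub>R axial_deriv \<phi> p"
    by (simp_all add: * smooth_even_axial_deriv(2)[OF assms] power2_eq_square)
qed

lemma axial_deriv_square:
  assumes "smooth_even \<phi>" "p \<in> W"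
  shows "axial_deriv (\<lambda>p. (snd p)\<^sup>2 *\<^sub>R \<phi> p) p = 2 *\<^sub>R \<phi> p + (snd p)\<^sup>2 *\<^sub>R axial_deriv \<phi> p"
proof (rule axial_deriv_unique)
  fix q assume q: "q \<in> W"
  have s: "((\<lambda>p. (snd p)\<^sup>2) has_derivative (\<lambda>h. 2 * snd q * snd h)) (at q)"
    by (auto intro!: derivative_eq_intros)
  then have "(\<lambda>p. (snd p)\<^sup>2) differentiable (at q)"
    by (rule differentiableI)
  from partial_bilinear[OF bounded_bilinear_scaleR this smooth_even_differentiable[OF assms(1) q]]
  show "partial (0, 1) (\<lambda>p. (snd p)\<^sup>2 *\<^sub>R \<phi> p) q =
      snd q *\<^sub>R (2 *\<^sub>R \<phi> q + (snd q)\<^sup>2 *\<^sub>R axial_deriv \<phi> q)"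
    by (simp add: partial_eq_derivative[OF s] smooth_even_axial_deriv(2)[OF assms(1) q] algebra_simps)
qed (use assms in \<open>auto intro!: smooth_even_intros\<close>)

text \<open>Symmetry of the mixed derivatives, after writing the v-derivative as v times \<tau> and
  noting that v is constant in u.\<close>

lemma axial_deriv_partial:
  fixes \<phi> :: "real \<times> real \<Rightarrow> 'b::euclidean_space"
  assumes "smooth_even \<phi>" "p \<in> W"
  shows "axial_deriv (partial (1, 0) \<phi>) p = partial (1, 0) (axial_deriv \<phi>) p"
proof (rule axial_deriv_unique)
  fix q assume q: "q \<in> W"
  have "partial (0, 1) (partial (1, 0) \<phi>) q = partial (1, 0) (partial (0, 1) \<phi>) q"
    by (rule partial_commute[OF smooth_evenD(1)[OF assms(1)] open_domain q]) (auto simp: Basis_plane)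
  also have "\<dots> = partial (1, 0) (\<lambda>p. snd p *\<^sub>R axial_deriv \<phi> p) q"
    by (rule partial_cong[OF open_domain q smooth_even_axial_deriv(2)[OF assms(1)]])
  also have "\<dots> = snd q *\<^sub>R partial (1, 0) (axial_deriv \<phi>) q"
    by (rule partial_snd_scaleR(1)[OF smooth_even_axial_deriv(1)[OF assms(1)] q])
  finally show "partial (0, 1) (partial (1, 0) \<phi>) q = snd q *\<^sub>R partial (1, 0) (axial_deriv \<phi>) q" .
qed (use assms in \<open>auto intro!: smooth_even_intros\<close>)

text \<open>Since the second v-derivative is \<tau> + v^2 \<tau>^2, this is the axially symmetric
  potential equation \<open>\<phi>\<close>_uu + \<open>\<phi>\<close>_vv + (r - 1)/v
  \<open>\<phi>\<close>_v = 0, written without a singular coefficient. For r = n it says that the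
  lift of \<open>\<phi>\<close> to R^(n+1) is harmonic.\<close>

definition axial_ode :: "real \<Rightarrow> (real \<times> real \<Rightarrow> 'b::euclidean_space) \<Rightarrow> bool" where
  "axial_ode r \<phi> \<longleftrightarrow> (\<forall>p\<in>W. partial (1, 0) (partial (1, 0) \<phi>) p + r *\<^sub>R axial_deriv \<phi> p +
    (snd p)\<^sup>2 *\<^sub>R axial_deriv (axial_deriv \<phi>) p = 0)"

lemma axial_ode_scaleR:
  assumes \<phi>: "smooth_even \<phi>" and ode: "axial_ode r \<phi>"
  shows "axial_ode r (\<lambda>p. c *\<^sub>R \<phi> p)"
  unfolding axial_ode_def
proof
  fix p assume p: "p \<in> W"
  let ?\<psi> = "\<lambda>p. c *\<^sub>R \<phi> p"
  have scale: "partial (1, 0) ?\<psi> q = c *\<^sub>R partial (1, 0) \<phi> q" "axial_deriv ?\<psi> q = c *\<^sub>R axial_deriv \<phi> q"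
    if "q \<in> W" for q
    using that by (simp_all add: partial_bounded_linear[OF bounded_linear_scaleR_right]
        smooth_even_differentiable axial_deriv_scaleR \<phi>)
  have uu: "partial (1, 0) (partial (1, 0) ?\<psi>) p = c *\<^sub>R partial (1, 0) (partial (1, 0) \<phi>) p"
    using partial_cong[OF open_domain p scale(1)] p
    by (simp add: partial_bounded_linear[OF bounded_linear_scaleR_right] smooth_even_differentiable
        smooth_even_intros \<phi>)
  have vv: "axial_deriv (axial_deriv ?\<psi>) p = c *\<^sub>R axial_deriv (axial_deriv \<phi>) p"
    using axial_deriv_cong[OF _ scale(2) p] p by (simp add: axial_deriv_scaleR smooth_even_intros \<phi>)
  have "c *\<^sub>R (partial (1, 0) (partial (1, 0) \<phi>) p + r *\<^sub>R axial_deriv \<phi> p +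
      (snd p)\<^sup>2 *\<^sub>R axial_deriv (axial_deriv \<phi>) p) = 0"
    using ode p by (simp only: axial_ode_def scaleR_zero_right)
  then show "partial (1, 0) (partial (1, 0) ?\<psi>) p + r *\<^sub>R axial_deriv ?\<psi> p +
      (snd p)\<^sup>2 *\<^sub>R axial_deriv (axial_deriv ?\<psi>) p = 0"
    unfolding uu vv scale(2)[OF p] by (simp only: scaleR_add_right scaleR_scaleR mult.commute)
qed

text \<open>Apply \<tau> to the equation. It commutes with the u-derivatives, and passing it through
  v^2 produces the extra 2 \<tau>^2 \<open>\<phi>\<close> that raises r.\<close>

lemma axial_ode_axial_deriv:
  assumes \<phi>: "smooth_even \<phi>" and ode: "axial_ode r \<phi>"
  shows "axial_ode (r + 2) (axial_deriv \<phi>)"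
  unfolding axial_ode_def
proof
  fix p assume p: "p \<in> W"
  note [simp] = \<phi> smooth_even_intros
  let ?\<tau> = "axial_deriv \<phi>"
  have "axial_deriv (\<lambda>p. partial (1, 0) (partial (1, 0) \<phi>) p + r *\<^sub>R ?\<tau> p +
      (snd p)\<^sup>2 *\<^sub>R axial_deriv ?\<tau> p) p = axial_deriv (\<lambda>p. 0 :: 'a) p"
    using ode by (intro axial_deriv_cong p) (simp_all add: axial_ode_def)
  also have "\<dots> = 0"
    by (simp add: axial_deriv_def odd_quotient_def)
  finally have "axial_deriv (partial (1, 0) (partial (1, 0) \<phi>)) p + r *\<^sub>R axial_deriv ?\<tau> p +
      (2 *\<^sub>R axial_deriv ?\<tau> p + (snd p)\<^sup>2 *\<^sub>R axial_deriv (axial_deriv ?\<tau>) p) = 0"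
    using p by (simp add: axial_deriv_add axial_deriv_scaleR axial_deriv_square)
  moreover have "axial_deriv (partial (1, 0) (partial (1, 0) \<phi>)) p = partial (1, 0) (partial (1, 0) ?\<tau>) p"
    using axial_deriv_partial[of "partial (1, 0) \<phi>" p] p
      partial_cong[OF open_domain p axial_deriv_partial[of \<phi>]] by simp
  ultimately show "partial (1, 0) (partial (1, 0) ?\<tau>) p + (r + 2) *\<^sub>R axial_deriv ?\<tau> p +
      (snd p)\<^sup>2 *\<^sub>R axial_deriv (axial_deriv ?\<tau>) p = 0"
    by (simp add: scaleR_add_left add_ac)
qed

end

section \<open>Axially symmetric domains\<close>

lemma Basis_paravector: "(Basis :: ('n::finite) paravector set) = insert (1, 0) (range (\<lambda>i. (0, axis i 1)))"
  by (auto simp: Basis_prod_def Basis_vec_def)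

definition axial_lift :: "(real \<times> real \<Rightarrow> 'b) \<Rightarrow> ('n::finite) paravector \<Rightarrow> 'b" where
  "axial_lift \<phi> x = \<phi> (fst x, norm (snd x))"

locale axial_domain =
  fixes U :: "('n::finite) paravector set"
  assumes open_U: "open U" and axially_symmetric_U: "axially_symmetric U"
begin

lemma slice_domain_iff:
  assumes "norm (I :: real ^ 'n) = 1"
  shows "(u, v) \<in> slice_domain U \<longleftrightarrow> (u, v *\<^sub>R I) \<in> U"
proof
  assume *: "(u, v *\<^sub>R I) \<in> U"
  have "(u, v *\<^sub>R J) \<in> U" if J: "norm J = 1" for J
  proof -
    \<comment> \<open>\<open>axial_class\<close> measures the radius by the norm, that is by |v|, so
      a negative v is absorbed into the direction.\<close>
    define J' where "J' = (if v \<ge> 0 then J else - J)"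
    have "norm J' = 1" "v *\<^sub>R J = norm (v *\<^sub>R I) *\<^sub>R J'"
      using J assms by (auto simp: J'_def)
    then have "(u, v *\<^sub>R J) \<in> axial_class (u, v *\<^sub>R I)"
      unfolding axial_class_def by auto
    with * axially_symmetric_U show ?thesis
      unfolding axially_symmetric_def by blast
  qed
  then show "(u, v) \<in> slice_domain U"
    by (simp add: slice_domain_def)
qed (use assms in \<open>simp add: slice_domain_def\<close>)

lemma slice_coordinates: "x \<in> U \<Longrightarrow> (fst x, norm (snd x)) \<in> slice_domain U"
proof -
  assume x: "x \<in> U"
  \<comment> \<open>At the origin of the vector part the direction is scaled by 0, so any unit
    vector will do.\<close>
  define I :: "real ^ 'n" where "I = (if snd x = 0 then axis undefined 1 else snd x /\<^sub>R norm (snd x))"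
  have "norm I = 1" "norm (snd x) *\<^sub>R I = snd x"
    by (auto simp: I_def)
  with x show ?thesis
    using slice_domain_iff[of I "fst x" "norm (snd x)"] by simp
qed

sublocale reflection_domain "slice_domain U"
proof
  define I :: "real ^ 'n" where "I = axis undefined 1"
  have I: "norm I = 1" "norm (- I) = 1"
    by (simp_all add: I_def)
  \<comment> \<open>By axial symmetry one direction decides membership, which makes the set a
    preimage of \<open>U\<close> under one continuous map.\<close>
  have "slice_domain U = (\<lambda>p. (fst p, snd p *\<^sub>R I)) -` U"
    using slice_domain_iff[OF I(1)] by auto
  then show "open (slice_domain U)"
    by (auto intro!: open_vimage open_U continuous_intros)
  show "(u, - v) \<in> slice_domain U" if "(u, v) \<in> slice_domain U" for u v
    using that slice_domain_iff[OF I(1), of u "- v"] slice_domain_iff[OF I(2), of u v] by simp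
qed

text \<open>Off the axis this is the chain rule: the factor v of the v-derivative cancels the
  denominator in the gradient x/|x| of the norm. On the axis the norm is not differentiable, but
  there the v-derivative of \<open>\<phi>\<close> vanishes.\<close>

lemma has_derivative_axial_lift:
  assumes \<phi>: "smooth_even \<phi>" and x: "x \<in> U"
  shows "(axial_lift \<phi> has_derivative
    (\<lambda>h. fst h *\<^sub>R axial_lift (partial (1, 0) \<phi>) x + (snd x \<bullet> snd h) *\<^sub>R axial_lift (axial_deriv \<phi>) x)) (at x)"
proof -
  define p where "p = (fst x, norm (snd x))"
  have p: "p \<in> slice_domain U"
    unfolding p_def using x by (rule slice_coordinates)
  have d: "(\<phi> has_derivative (\<lambda>h. fst h *\<^sub>R partial (1, 0) \<phi> p + snd h *\<^sub>R (snd p *\<^sub>R axial_deriv \<phi> p))) (at p)"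
    using has_derivative_plane[OF smooth_even_differentiable[OF \<phi> p]]
    by (simp add: smooth_even_axial_deriv(2)[OF \<phi> p])
  show ?thesis
  proof (cases "snd x = 0")
    case False
    have "(norm has_derivative (\<lambda>h. inner (sgn (snd x)) h)) (at (snd x))"
      using has_derivative_norm[of "snd x"] False by (simp add: inner_commute)
    from has_derivative_compose[OF bounded_linear_imp_has_derivative[OF bounded_linear_snd] this]
    have "((\<lambda>x. (fst x, norm (snd x))) has_derivative (\<lambda>h. (fst h, inner (sgn (snd x)) (snd h)))) (at x)"
      by (intro has_derivative_Pair bounded_linear_imp_has_derivative[OF bounded_linear_fst])
    from has_derivative_compose[OF this d[unfolded p_def]]
    show ?thesis
      unfolding axial_lift_def[abs_def]
      by (rule has_derivative_eq_rhs) (use False in \<open>simp add: sgn_div_norm field_simps\<close>)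
  next
    case True
    have "(axial_lift \<phi> has_derivative (\<lambda>h. fst h *\<^sub>R partial (1, 0) \<phi> p)) (at x)"
      unfolding has_derivative_at_alt
    proof (intro conjI allI impI)
      show "bounded_linear (\<lambda>h :: 'n paravector. fst h *\<^sub>R partial (1, 0) \<phi> p)"
        by (intro bounded_linear_scaleR_const bounded_linear_fst)
      fix e :: real assume "e > 0"
      have d': "(\<phi> has_derivative (\<lambda>h. fst h *\<^sub>R partial (1, 0) \<phi> p)) (at p)"
        using d True by (simp add: p_def)
      then obtain r where r: "r > 0"
        "\<And>q. norm (q - p) < r \<Longrightarrow> norm (\<phi> q - \<phi> p - fst (q - p) *\<^sub>R partial (1, 0) \<phi> p) \<le> e * norm (q - p)"
        using \<open>e > 0\<close> unfolding has_derivative_at_alt by blast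
      have "norm (axial_lift \<phi> y - axial_lift \<phi> x - fst (y - x) *\<^sub>R partial (1, 0) \<phi> p) \<le> e * norm (y - x)"
        if "norm (y - x) < r" for y
      proof -
        \<comment> \<open>Folding to the half-plane preserves the distance to a point of the axis,
          so the error bound for \<open>\<phi>\<close> at \<open>p\<close> is literally one for the
          lift at \<open>x\<close>.\<close>
        have "norm ((fst y, norm (snd y)) - p) = norm (y - x)"
          using True by (simp add: p_def norm_prod_def)
        with r(2)[of "(fst y, norm (snd y))"] that show ?thesis
          by (simp add: axial_lift_def p_def)
      qed
      with r(1) show "\<exists>r>0. \<forall>y. norm (y - x) < r \<longrightarrow>
          norm (axial_lift \<phi> y - axial_lift \<phi> x - fst (y - x) *\<^sub>R partial (1, 0) \<phi> p) \<le> e * norm (y - x)"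
        by blast
    qed
    with True show ?thesis
      by (simp add: axial_lift_def p_def)
  qed
qed

lemma partial_axial_lift:
  assumes "smooth_even \<phi>" "x \<in> U"
  shows "partial_0 (axial_lift \<phi>) x = axial_lift (partial (1, 0) \<phi>) x"
    and "partial_vec i (axial_lift \<phi>) x = (snd x $ i) *\<^sub>R axial_lift (axial_deriv \<phi>) x"
  using partial_eq_derivative[OF has_derivative_axial_lift[OF assms]] by (simp_all add: inner_axis)

text \<open>Partial derivatives of a lift are again lifts of smooth even functions, up to a
  coordinate factor, so the induction generalises over \<open>\<phi>\<close>.\<close>

lemma C_infinity_axial_lift:
  assumes "smooth_even \<phi>"
  shows "C_infinity (axial_lift \<phi>) U"
proof -
  have "C_class k (axial_lift \<phi>) U" for k
    using assms
  proof (induction k arbitrary: \<phi>)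
    case 0
    then show ?case
      using has_derivative_continuous[OF has_derivative_axial_lift[OF 0]]
      by (auto intro: continuous_at_imp_continuous_on)
  next
    case (Suc k)
    have "C_class k (partial_0 (axial_lift \<phi>)) U"
      using C_class_cong[OF open_U partial_axial_lift(1)[OF Suc.prems]]
        Suc.IH[OF smooth_even_partial(1)[OF Suc.prems]] by simp
    moreover have "C_class k (partial_vec i (axial_lift \<phi>)) U" for i
    proof -
      have "bounded_linear (\<lambda>x :: 'n paravector. snd x $ i)"
        by (rule bounded_linear_compose[OF bounded_linear_vec_nth bounded_linear_snd])
      then have "C_class k (\<lambda>x :: 'n paravector. snd x $ i) U"
        using C_infinity_linear by (auto simp: C_infinity_def)
      then have "C_class k (\<lambda>x. (snd x $ i) *\<^sub>R axial_lift (axial_deriv \<phi>) x) U"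
        by (intro C_class_bilinear[OF open_U bounded_bilinear_scaleR] Suc.IH
            smooth_even_axial_deriv(1)[OF Suc.prems])
      then show ?thesis
        using C_class_cong[OF open_U partial_axial_lift(2)[OF Suc.prems]] by simp
    qed
    moreover have "axial_lift \<phi> differentiable_on U"
      using differentiableI[OF has_derivative_axial_lift[OF Suc.prems]]
      by (simp add: differentiable_on_eq_differentiable_at open_U)
    ultimately show ?case
      by (auto simp: Basis_paravector)
  qed
  then show ?thesis
    by (simp add: C_infinity_def)
qed

end

section \<open>Operators on smooth functions over \<open>U\<close>, up to equality on
  \<open>U\<close>\<close>

locale axial_clifford_domain = axial_domain U for U :: "('n::{finite,linorder}) paravector set"
begin

text \<open>Nothing is known outside \<open>U\<close>, so operator identities cannot be equations
  between functions.\<close>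

definition agree :: "'n clifford_fun \<Rightarrow> 'n clifford_fun \<Rightarrow> bool" (infix \<open>\<simeq>\<close> 50) where
  "g \<simeq> g' \<longleftrightarrow> (\<forall>x\<in>U. g x = g' x)"

lemma agree_refl [simp]: "g \<simeq> g"
  and agree_sym: "g \<simeq> g' \<Longrightarrow> g' \<simeq> g"
  and agree_trans [trans]: "g \<simeq> g' \<Longrightarrow> g' \<simeq> g'' \<Longrightarrow> g \<simeq> g''"
  by (simp_all add: agree_def)

lemma partial_agree: "g \<simeq> g' \<Longrightarrow> partial b g \<simeq> partial b g'"
  unfolding agree_def using partial_cong[OF open_U] by blast

lemma C_infinity_agree: "g \<simeq> g' \<Longrightarrow> C_infinity g U \<longleftrightarrow> C_infinity g' U"
  unfolding agree_def using C_infinity_cong[OF open_U] by blast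

text \<open>The second clause is the substitution rule: an identity valid on \<open>U\<close> may be
  rewritten below an operator and its iterates.\<close>

definition smooth_operator :: "('n clifford_fun \<Rightarrow> 'n clifford_fun) \<Rightarrow> bool" where
  "smooth_operator P \<longleftrightarrow>
    (\<forall>g. C_infinity g U \<longrightarrow> C_infinity (P g) U) \<and> (\<forall>g g'. g \<simeq> g' \<longrightarrow> P g \<simeq> P g')"

lemma smooth_operatorD:
  assumes "smooth_operator P"
  shows "C_infinity g U \<Longrightarrow> C_infinity (P g) U" "g \<simeq> g' \<Longrightarrow> P g \<simeq> P g'"
  using assms by (auto simp: smooth_operator_def)

lemma smooth_operator_funpow: "smooth_operator P \<Longrightarrow> smooth_operator (P ^^ k)"
  by (induction k) (auto simp: smooth_operator_def)

text \<open>Commutation is available for smooth arguments only, so smoothness is propagated while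
  one \<open>P\<close> is moved past all \<open>Q\<close>, and then all \<open>P\<close>
  are.\<close>

lemma funpow_commute:
  assumes P: "smooth_operator P" and Q: "smooth_operator Q"
    and comm: "\<And>g. C_infinity g U \<Longrightarrow> P (Q g) \<simeq> Q (P g)"
    and g: "C_infinity g U"
  shows "(P ^^ m) ((Q ^^ k) g) \<simeq> (Q ^^ k) ((P ^^ m) g)"
proof -
  have *: "P ((Q ^^ k) g) \<simeq> (Q ^^ k) (P g)" if g: "C_infinity g U" for g k
  proof (induction k)
    case (Suc k)
    have "P (Q ((Q ^^ k) g)) \<simeq> Q (P ((Q ^^ k) g))"
      by (intro comm smooth_operatorD(1)[OF smooth_operator_funpow[OF Q]] g)
    also have "\<dots> \<simeq> Q ((Q ^^ k) (P g))"
      by (rule smooth_operatorD(2)[OF Q Suc])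
    finally show ?case
      by simp
  qed simp
  show ?thesis
  proof (induction m)
    case (Suc m)
    have "P ((P ^^ m) ((Q ^^ k) g)) \<simeq> P ((Q ^^ k) ((P ^^ m) g))"
      by (rule smooth_operatorD(2)[OF P Suc])
    also have "\<dots> \<simeq> (Q ^^ k) (P ((P ^^ m) g))"
      by (intro * smooth_operatorD(1)[OF smooth_operator_funpow[OF P]] g)
    finally show ?case
      by simp
  qed simp
qed

lemma smooth_operator_laplacian: "smooth_operator laplacian"
  unfolding smooth_operator_def
proof (intro conjI allI impI)
  fix g :: "'n clifford_fun" assume "C_infinity g U"
  then show "C_infinity (laplacian g) U"
    unfolding laplacian_def[abs_def]
    by (intro C_infinity_add C_infinity_sum open_U C_infinity_partial) (auto simp: Basis_paravector)
next
  fix g g' :: "'n clifford_fun" assume "g \<simeq> g'"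
  then have "partial b (partial b g) \<simeq> partial b (partial b g')" for b
    by (intro partial_agree)
  then show "laplacian g \<simeq> laplacian g'"
    by (simp add: agree_def laplacian_def)
qed

lemma axial_lift_cong: "(\<And>p. p \<in> slice_domain U \<Longrightarrow> \<phi> p = \<psi> p) \<Longrightarrow> axial_lift \<phi> \<simeq> axial_lift \<psi>"
  unfolding agree_def axial_lift_def using slice_coordinates by blast

text \<open>Each second derivative in x_i gives \<tau> \<open>\<phi>\<close> + x_i^2 \<tau>^2
  \<open>\<phi>\<close>; the sum over i produces the factors n and |x|^2 = v^2.\<close>

lemma laplacian_axial_lift:
  assumes \<phi>: "smooth_even \<phi>"
  shows "laplacian (axial_lift \<phi>) \<simeq> axial_lift (\<lambda>p. partial (1, 0) (partial (1, 0) \<phi>) p +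
    real CARD('n) *\<^sub>R axial_deriv \<phi> p + (snd p)\<^sup>2 *\<^sub>R axial_deriv (axial_deriv \<phi>) p)"
  unfolding agree_def
proof
  fix x assume x: "x \<in> U"
  have "partial_0 (partial_0 (axial_lift \<phi>)) x = partial_0 (axial_lift (partial (1, 0) \<phi>)) x"
    by (rule partial_cong[OF open_U x partial_axial_lift(1)[OF \<phi>]])
  also have "\<dots> = axial_lift (partial (1, 0) (partial (1, 0) \<phi>)) x"
    by (rule partial_axial_lift(1)[OF smooth_even_partial(1)[OF \<phi>] x])
  finally have 0: "partial_0 (partial_0 (axial_lift \<phi>)) x = axial_lift (partial (1, 0) (partial (1, 0) \<phi>)) x" .
  let ?\<psi> = "axial_deriv \<phi>"
  have \<psi>: "smooth_even ?\<psi>"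
    by (rule smooth_even_axial_deriv(1)[OF \<phi>])
  have i: "partial_vec i (partial_vec i (axial_lift \<phi>)) x =
      axial_lift ?\<psi> x + (snd x $ i)\<^sup>2 *\<^sub>R axial_lift (axial_deriv ?\<psi>) x" for i
  proof -
    have l: "((\<lambda>x :: 'n paravector. snd x $ i) has_derivative (\<lambda>h. snd h $ i)) (at x)"
      by (rule bounded_linear_imp_has_derivative[OF
            bounded_linear_compose[OF bounded_linear_vec_nth bounded_linear_snd]])
    have "partial_vec i (partial_vec i (axial_lift \<phi>)) x = partial_vec i (\<lambda>x. (snd x $ i) *\<^sub>R axial_lift ?\<psi> x) x"
      by (rule partial_cong[OF open_U x partial_axial_lift(2)[OF \<phi>]])
    also have "\<dots> = (snd x $ i) *\<^sub>R partial_vec i (axial_lift ?\<psi>) x +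
        partial_vec i (\<lambda>x :: 'n paravector. snd x $ i) x *\<^sub>R axial_lift ?\<psi> x"
      by (rule partial_bilinear[OF bounded_bilinear_scaleR differentiableI[OF l]
            differentiableI[OF has_derivative_axial_lift[OF \<psi> x]]])
    finally show ?thesis
      by (simp add: partial_eq_derivative[OF l] partial_axial_lift(2)[OF \<psi> x] power2_eq_square)
  qed
  have "(\<Sum>i\<in>UNIV. (snd x $ i)\<^sup>2) = (norm (snd x))\<^sup>2"
    by (simp add: norm_vec_def L2_set_def sum_nonneg)
  then show "laplacian (axial_lift \<phi>) x = axial_lift (\<lambda>p. partial (1, 0) (partial (1, 0) \<phi>) p +
    real CARD('n) *\<^sub>R axial_deriv \<phi> p + (snd p)\<^sup>2 *\<^sub>R axial_deriv (axial_deriv \<phi>) p) x"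
    by (simp add: laplacian_def 0 i sum.distrib sum_constant_scaleR axial_lift_def
        del: sum_constant flip: scaleR_sum_left)
qed

text \<open>Subtracting the equation with parameter r from the formula for the Laplacian leaves (n -
  r) \<tau> \<open>\<phi>\<close>. Here \<open>j\<close> counts the steps of size 2 still missing
  until r = n, where the Laplacian vanishes.\<close>

lemma laplacian_funpow_axial_lift:
  fixes \<phi> :: "real \<times> real \<Rightarrow> 'n clifford"
  assumes "smooth_even \<phi>" "axial_ode (real CARD('n) - 2 * real j) \<phi>"
  shows "(laplacian ^^ Suc j) (axial_lift \<phi>) \<simeq> (\<lambda>x. 0)"
  using assms
proof (induction j arbitrary: \<phi>)
  case 0
  show ?case
    using agree_trans[OF laplacian_axial_lift[OF 0(1)] axial_lift_cong[of _ "\<lambda>p. 0"]] 0(2)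
    by (simp add: axial_ode_def axial_lift_def[abs_def])
next
  case (Suc j)
  define r where "r = real CARD('n) - 2 * real (Suc j)"
  define \<psi> where "\<psi> = (\<lambda>p. (real CARD('n) - r) *\<^sub>R axial_deriv \<phi> p)"
  have "laplacian (axial_lift \<phi>) \<simeq> axial_lift \<psi>"
  proof -
    have "partial (1, 0) (partial (1, 0) \<phi>) p + real CARD('n) *\<^sub>R axial_deriv \<phi> p +
        (snd p)\<^sup>2 *\<^sub>R axial_deriv (axial_deriv \<phi>) p = \<psi> p" if "p \<in> slice_domain U" for p
      using Suc.prems(2) that unfolding \<psi>_def r_def[symmetric] scaleR_diff_left
      by (simp add: axial_ode_def algebra_simps eq_neg_iff_add_eq_0)
    then show ?thesis
      by (rule agree_trans[OF laplacian_axial_lift[OF Suc.prems(1)] axial_lift_cong])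
  qed
  then have "(laplacian ^^ Suc j) (laplacian (axial_lift \<phi>)) \<simeq> (laplacian ^^ Suc j) (axial_lift \<psi>)"
    by (rule smooth_operatorD(2)[OF smooth_operator_funpow[OF smooth_operator_laplacian]])
  also have "\<dots> \<simeq> (\<lambda>x. 0)"
  proof (rule Suc.IH)
    show "smooth_even \<psi>"
      unfolding \<psi>_def by (intro smooth_even_intros Suc.prems)
    have "r + 2 = real CARD('n) - 2 * real j"
      by (simp add: r_def)
    then show "axial_ode (real CARD('n) - 2 * real j) \<psi>"
      using axial_ode_scaleR[OF smooth_even_axial_deriv(1) axial_ode_axial_deriv, OF Suc.prems(1) Suc.prems(1)]
        Suc.prems(2) unfolding \<psi>_def r_def[symmetric] by metis
  qed
  finally show ?case
    by (simp only: funpow_Suc_right o_apply)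
qed

end

section \<open>Dirac operators of a Clifford action\<close>

text \<open>
  Left and right multiplication by the generators satisfy the same anticommutation rule, so both
  versions of every operator are instances of one construction.
\<close>

locale clifford_action = axial_clifford_domain U for U :: "('n::{finite,linorder}) paravector set" +
  fixes E :: "'n \<Rightarrow> 'n clifford \<Rightarrow> 'n clifford"
  assumes linear_E: "linear (E i)"
    and anticommute: "E i (E j c) + E j (E i c) = (if i = j then - 2 *\<^sub>R c else 0)"
begin

text \<open>The sign \<open>\<sigma>\<close> covers D (1) and its conjugate (-1) in one
  computation.\<close>

definition dirac :: "real \<Rightarrow> 'n clifford_fun \<Rightarrow> 'n clifford_fun" where
  "dirac \<sigma> g x = partial_0 g x + \<sigma> *\<^sub>R (\<Sum>i\<in>UNIV. E i (partial_vec i g x))"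

text \<open>Multiplication by \<open>clifford_vec v\<close> from the side chosen by
  \<open>E\<close>.\<close>

definition vec_action :: "(real, 'n) vec \<Rightarrow> 'n clifford \<Rightarrow> 'n clifford" where
  "vec_action v c = (\<Sum>i\<in>UNIV. v $ i *\<^sub>R E i c)"

lemmas E_simps = linear_add[OF linear_E] linear_diff[OF linear_E] linear_scale[OF linear_E]
  linear_sum[OF linear_E] linear_neg[OF linear_E]

lemma bounded_linear_E: "bounded_linear (E i)"
  using linear_E linear_conv_bounded_linear by blast

text \<open>Adding the sum to its copy with i and j exchanged pairs the two orders of the
  generators; the off-diagonal pairs cancel. With H = v_i v_j it gives x x = -|x|^2, with second
  partial derivatives the factorisation of the Laplacian.\<close>

lemma sum_symmetric_action:
  assumes "\<And>i j. H i j = H j i"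
  shows "(\<Sum>i\<in>UNIV. \<Sum>j\<in>UNIV. E i (E j (H i j))) = - (\<Sum>i\<in>UNIV. H i i)"
proof -
  let ?S = "\<Sum>i\<in>UNIV. \<Sum>j\<in>UNIV. E i (E j (H i j))"
  have "2 *\<^sub>R ?S = ?S + (\<Sum>i\<in>UNIV. \<Sum>j\<in>UNIV. E j (E i (H i j)))"
    using assms by (subst (2) sum.swap) (simp add: scaleR_2)
  also have "\<dots> = (\<Sum>i\<in>UNIV. \<Sum>j\<in>UNIV. if i = j then - 2 *\<^sub>R H i j else 0)"
    by (simp only: anticommute flip: sum.distrib)
  also have "\<dots> = 2 *\<^sub>R (- (\<Sum>i\<in>UNIV. H i i))"
    by (simp add: scaleR_sum_right sum_negf)
  finally show ?thesis
    by (simp only: scaleR_cancel_left) simp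
qed

lemma vec_action_vec_action: "vec_action v (vec_action v c) = - (norm v)\<^sup>2 *\<^sub>R c"
proof -
  have "vec_action v (vec_action v c) = (\<Sum>i\<in>UNIV. \<Sum>j\<in>UNIV. E i (E j ((v $ i * v $ j) *\<^sub>R c)))"
    by (simp add: vec_action_def E_simps scaleR_sum_right)
  also have "\<dots> = - (\<Sum>i\<in>UNIV. (v $ i * v $ i) *\<^sub>R c)"
    by (rule sum_symmetric_action) (simp add: mult.commute)
  also have "\<dots> = - (norm v)\<^sup>2 *\<^sub>R c"
    by (simp add: norm_vec_def L2_set_def sum_nonneg power2_eq_square scaleR_sum_left)
  finally show ?thesis .
qed

lemma bounded_bilinear_vec_action: "bounded_bilinear vec_action"
  unfolding bilinear_conv_bounded_bilinear[symmetric] bilinear_def vec_action_def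
  by (auto intro!: linearI simp: E_simps algebra_simps sum.distrib scaleR_sum_right)

interpretation vec_action: bounded_bilinear vec_action
  by (rule bounded_bilinear_vec_action)

lemma vec_action_axis: "vec_action (axis i 1) c = E i c"
  by (simp add: vec_action_def axis_def if_distrib[of "\<lambda>r. r *\<^sub>R _"] cong: if_cong)

lemma smooth_operator_dirac: "smooth_operator (dirac \<sigma>)"
  unfolding smooth_operator_def
proof (intro conjI allI impI)
  fix g :: "'n clifford_fun" assume "C_infinity g U"
  then show "C_infinity (dirac \<sigma> g) U"
    unfolding dirac_def[abs_def]
    by (intro C_infinity_add C_infinity_scaleR C_infinity_const C_infinity_sum open_U
        C_infinity_bounded_linear[OF _ bounded_linear_E] C_infinity_partial) (auto simp: Basis_paravector)
next
  fix g g' :: "'n clifford_fun" assume "g \<simeq> g'"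
  then have "partial b g \<simeq> partial b g'" for b
    by (rule partial_agree)
  then show "dirac \<sigma> g \<simeq> dirac \<sigma> g'"
    by (simp add: agree_def dirac_def)
qed

text \<open>The mixed terms in x_0 and x_i cancel by symmetry of second derivatives, and the terms
  without x_0 collapse to the diagonal by \<open>sum_symmetric_action\<close>.\<close>

lemma dirac_dirac:
  assumes g: "C_infinity g U" and \<sigma>: "\<sigma> * \<sigma> = 1"
  shows "dirac \<sigma> (dirac (- \<sigma>) g) \<simeq> laplacian g"
  unfolding agree_def
proof
  fix x assume x: "x \<in> U"
  have p: "C_infinity (partial_0 g) U" "C_infinity (partial_vec i g) U" for i
    using g by (auto intro!: C_infinity_partial simp: Basis_paravector)
  have d: "partial_0 g differentiable (at x)" "partial_vec i g differentiable (at x)" for i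
    using C_infinity_differentiable[OF p(1) open_U x] C_infinity_differentiable[OF p(2) open_U x] by blast+
  have dE: "(\<lambda>x. E i (partial_vec i g x)) differentiable (at x)" for i
    using d(2) bounded_linear.has_derivative[OF bounded_linear_E] unfolding differentiable_def by blast
  have comm: "partial_vec i (partial_0 g) x = partial_0 (partial_vec i g) x"
    "partial_vec i (partial_vec j g) x = partial_vec j (partial_vec i g) x" for i j
    by (rule partial_commute[OF g open_U x]; simp add: Basis_paravector)+
  have D: "partial b (dirac (- \<sigma>) g) x = partial b (partial_0 g) x -
      \<sigma> *\<^sub>R (\<Sum>j\<in>UNIV. E j (partial b (partial_vec j g) x))" for b
  proof -
    have "partial b (dirac (- \<sigma>) g) x = partial b (partial_0 g) x +
        partial b (\<lambda>x. (- \<sigma>) *\<^sub>R (\<Sum>j\<in>UNIV. E j (partial_vec j g x))) x"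
      unfolding dirac_def[abs_def]
      using differentiable_sum'[of UNIV "\<lambda>i x. E i (partial_vec i g x)", OF dE]
        bounded_linear.has_derivative[OF bounded_linear_scaleR_right, of "\<lambda>x. \<Sum>j\<in>UNIV. E j (partial_vec j g x)" _ _ "- \<sigma>"]
      by (intro partial_add d) (unfold differentiable_def, blast)
    also have "partial b (\<lambda>x. (- \<sigma>) *\<^sub>R (\<Sum>j\<in>UNIV. E j (partial_vec j g x))) x =
        (- \<sigma>) *\<^sub>R partial b (\<lambda>x. \<Sum>j\<in>UNIV. E j (partial_vec j g x)) x"
      by (rule partial_bounded_linear[OF bounded_linear_scaleR_right differentiable_sum']) (rule dE)
    also have "partial b (\<lambda>x. \<Sum>j\<in>UNIV. E j (partial_vec j g x)) x =
        (\<Sum>j\<in>UNIV. E j (partial b (partial_vec j g) x))"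
      by (simp add: partial_sum dE partial_bounded_linear[OF bounded_linear_E d(2)])
    finally show ?thesis
      by simp
  qed
  have "(\<Sum>i\<in>UNIV. E i (\<Sum>j\<in>UNIV. E j (partial_vec i (partial_vec j g) x))) =
      - (\<Sum>i\<in>UNIV. partial_vec i (partial_vec i g) x)"
    using sum_symmetric_action[of "\<lambda>i j. partial_vec i (partial_vec j g) x"] comm(2) by (simp add: E_simps)
  then show "dirac \<sigma> (dirac (- \<sigma>) g) x = laplacian g x"
    using \<sigma> by (simp add: dirac_def[of \<sigma>] laplacian_def D E_simps comm(1) sum_subtractf
        scaleR_diff_right scaleR_add_right scaleR_sum_right[symmetric])
qed

text \<open>Both sides are the threefold product with signs \<open>\<sigma>\<close>,
  \<open>- \<sigma>\<close>, \<open>\<sigma>\<close>, bracketed in two ways.\<close>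

lemma dirac_laplacian:
  assumes g: "C_infinity g U" and \<sigma>: "\<sigma> * \<sigma> = 1"
  shows "dirac \<sigma> (laplacian g) \<simeq> laplacian (dirac \<sigma> g)"
proof -
  have "laplacian (dirac \<sigma> g) \<simeq> dirac \<sigma> (dirac (- \<sigma>) (dirac \<sigma> g))"
    by (intro agree_sym[OF dirac_dirac] smooth_operatorD(1)[OF smooth_operator_dirac] assms)
  also have "\<dots> \<simeq> dirac \<sigma> (laplacian g)"
    using dirac_dirac[OF g, of "- \<sigma>"] \<sigma> by (intro smooth_operatorD(2)[OF smooth_operator_dirac]) simp
  finally show ?thesis
    by (rule agree_sym)
qed

lemma dirac_commute:
  assumes g: "C_infinity g U"
  shows "dirac (- 1) (dirac 1 g) \<simeq> dirac 1 (dirac (- 1) g)"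
  using agree_trans[OF dirac_dirac[OF g, of "- 1"] agree_sym[OF dirac_dirac[OF g, of 1]]] by simp

lemma dirac_funpow_commute:
  assumes "C_infinity g U"
  shows "(dirac 1 ^^ m) ((dirac (- 1) ^^ k) g) \<simeq> (dirac (- 1) ^^ k) ((dirac 1 ^^ m) g)"
  by (rule funpow_commute[OF smooth_operator_dirac smooth_operator_dirac _ assms])
    (rule agree_sym[OF dirac_commute])

lemma dirac_funpow_dirac_funpow:
  assumes "C_infinity g U"
  shows "(dirac 1 ^^ r) ((dirac (- 1) ^^ r) g) \<simeq> (laplacian ^^ r) g"
  using assms
proof (induction r arbitrary: g)
  case (Suc r)
  let ?D = "dirac 1" and ?D' = "dirac (- 1)"
  note D = smooth_operator_dirac[of 1] smooth_operator_dirac[of "- 1"]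
  \<comment> \<open>The innermost \<open>?D\<close> is moved next to the innermost
    \<open>?D'\<close>, where the two merge into one Laplacian.\<close>
  have "(?D ^^ r) (?D ((?D' ^^ r) (?D' g))) \<simeq> (?D ^^ r) ((?D' ^^ r) (?D (?D' g)))"
    using dirac_funpow_commute[OF smooth_operatorD(1)[OF D(2) Suc.prems], of 1 r]
    by (intro smooth_operatorD(2)[OF smooth_operator_funpow[OF D(1)]]) simp
  also have "\<dots> \<simeq> (laplacian ^^ r) (?D (?D' g))"
    by (intro Suc.IH smooth_operatorD(1)[OF D(1)] smooth_operatorD(1)[OF D(2)] Suc.prems)
  also have "\<dots> \<simeq> (laplacian ^^ r) (laplacian g)"
    using dirac_dirac[OF Suc.prems, of 1]
    by (intro smooth_operatorD(2)[OF smooth_operator_funpow[OF smooth_operator_laplacian]]) simp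
  finally show ?case
    by (simp only: funpow_Suc_right o_apply)
qed simp

text \<open>The action is by x and not by x/|x|: the odd part is divided by v beforehand, so both
  coefficients are even and nothing is singular on the axis.\<close>

definition axial_rep :: "(real \<times> real \<Rightarrow> 'n clifford) \<Rightarrow> (real \<times> real \<Rightarrow> 'n clifford) \<Rightarrow> 'n clifford_fun \<Rightarrow> bool" where
  "axial_rep A B g \<longleftrightarrow> smooth_even A \<and> smooth_even B \<and>
    g \<simeq> (\<lambda>x. axial_lift A x + vec_action (snd x) (axial_lift B x))"

text \<open>Differentiating the factor x contributes the sum of the squares of the generators, that
  is -n B; differentiating B contributes x x \<tau> B = -v^2 \<tau> B.\<close>

lemma axial_rep_dirac:
  assumes "axial_rep A B g"
  shows "axial_rep
    (\<lambda>p. partial (1, 0) A p - \<sigma> *\<^sub>R (real CARD('n) *\<^sub>R B p + (snd p)\<^sup>2 *\<^sub>R axial_deriv B p))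
    (\<lambda>p. partial (1, 0) B p + \<sigma> *\<^sub>R axial_deriv A p) (dirac \<sigma> g)"
  unfolding axial_rep_def
proof (intro conjI)
  have A: "smooth_even A" and B: "smooth_even B"
    and g: "g \<simeq> (\<lambda>x. axial_lift A x + vec_action (snd x) (axial_lift B x))" (is "g \<simeq> ?g")
    using assms by (simp_all add: axial_rep_def)
  show "smooth_even (\<lambda>p. partial (1, 0) A p - \<sigma> *\<^sub>R (real CARD('n) *\<^sub>R B p + (snd p)\<^sup>2 *\<^sub>R axial_deriv B p))"
    "smooth_even (\<lambda>p. partial (1, 0) B p + \<sigma> *\<^sub>R axial_deriv A p)"
    by (intro smooth_even_intros A B)+
  have "dirac \<sigma> g \<simeq> dirac \<sigma> ?g"
    by (rule smooth_operatorD(2)[OF smooth_operator_dirac g])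
  also have "dirac \<sigma> ?g \<simeq> (\<lambda>x. axial_lift (\<lambda>p. partial (1, 0) A p -
        \<sigma> *\<^sub>R (real CARD('n) *\<^sub>R B p + (snd p)\<^sup>2 *\<^sub>R axial_deriv B p)) x +
      vec_action (snd x) (axial_lift (\<lambda>p. partial (1, 0) B p + \<sigma> *\<^sub>R axial_deriv A p) x))"
    unfolding agree_def
  proof
    fix x assume x: "x \<in> U"
    have d: "(?g has_derivative (\<lambda>h. (fst h *\<^sub>R axial_lift (partial (1, 0) A) x +
        (snd x \<bullet> snd h) *\<^sub>R axial_lift (axial_deriv A) x) +
        (vec_action (snd x) (fst h *\<^sub>R axial_lift (partial (1, 0) B) x + (snd x \<bullet> snd h) *\<^sub>R axial_lift (axial_deriv B) x) +
         vec_action (snd h) (axial_lift B x)))) (at x)"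
      by (intro has_derivative_add vec_action.FDERIV has_derivative_axial_lift A B x
          bounded_linear_imp_has_derivative[OF bounded_linear_snd])
    have 0: "partial_0 ?g x = axial_lift (partial (1, 0) A) x + vec_action (snd x) (axial_lift (partial (1, 0) B) x)"
      using partial_eq_derivative[OF d] by (simp add: vec_action.zero_left)
    have "E i (partial_vec i ?g x) = (snd x $ i) *\<^sub>R E i (axial_lift (axial_deriv A) x) +
        (snd x $ i) *\<^sub>R E i (vec_action (snd x) (axial_lift (axial_deriv B) x)) + E i (E i (axial_lift B x))" for i
      using partial_eq_derivative[OF d, of "(0, axis i 1)"]
      by (simp add: inner_axis vec_action_axis E_simps vec_action.scaleR_right)
    moreover have "E i (E i c) = - c" for i c
    proof -
      have "2 *\<^sub>R E i (E i c) = 2 *\<^sub>R (- c)"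
        using anticommute[of i i c] by (simp add: scaleR_2)
      then show ?thesis
        by (simp only: scaleR_cancel_left) simp
    qed
    ultimately have vec: "(\<Sum>i\<in>UNIV. E i (partial_vec i ?g x)) = vec_action (snd x) (axial_lift (axial_deriv A) x) +
        vec_action (snd x) (vec_action (snd x) (axial_lift (axial_deriv B) x)) - real CARD('n) *\<^sub>R axial_lift B x"
      by (simp add: sum.distrib sum_subtractf sum_constant_scaleR flip: vec_action_def del: sum_constant)
    then show "dirac \<sigma> ?g x = axial_lift (\<lambda>p. partial (1, 0) A p -
        \<sigma> *\<^sub>R (real CARD('n) *\<^sub>R B p + (snd p)\<^sup>2 *\<^sub>R axial_deriv B p)) x +
      vec_action (snd x) (axial_lift (\<lambda>p. partial (1, 0) B p + \<sigma> *\<^sub>R axial_deriv A p) x)"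
      unfolding dirac_def 0 vec
      by (simp add: vec_action_vec_action axial_lift_def vec_action.add_right
          vec_action.scaleR_right algebra_simps)
  qed
  finally show "dirac \<sigma> g \<simeq> (\<lambda>x. axial_lift (\<lambda>p. partial (1, 0) A p -
        \<sigma> *\<^sub>R (real CARD('n) *\<^sub>R B p + (snd p)\<^sup>2 *\<^sub>R axial_deriv B p)) x +
      vec_action (snd x) (axial_lift (\<lambda>p. partial (1, 0) B p + \<sigma> *\<^sub>R axial_deriv A p) x))" .
qed

lemma axial_rep_dirac_funpow: "\<exists>A B. axial_rep A B g \<Longrightarrow> \<exists>A B. axial_rep A B ((dirac \<sigma> ^^ k) g)"
  by (induction k) (auto dest: axial_rep_dirac)

lemma axial_rep_C_infinity:
  assumes "axial_rep A B g"
  shows "C_infinity g U"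
proof -
  have "C_infinity (\<lambda>x. axial_lift A x + vec_action (snd x) (axial_lift B x)) U"
    using assms unfolding axial_rep_def
    by (intro C_infinity_add open_U C_infinity_axial_lift C_infinity_bilinear[OF _ bounded_bilinear_vec_action]
        C_infinity_linear bounded_linear_snd) auto
  then show ?thesis
    using assms C_infinity_agree by (auto simp: axial_rep_def)
qed

lemma axial_rep_axial_form:
  assumes "axial_rep A B g"
  shows "\<exists>A B. even_odd_pair A B (slice_domain U) \<and>
    (\<forall>(x0, x)\<in>U. g (x0, x) = A (x0, norm x) + vec_action (x /\<^sub>R norm x) (B (x0, norm x)))"
proof (intro exI conjI)
  show "even_odd_pair A (\<lambda>p. snd p *\<^sub>R B p) (slice_domain U)"
    using assms by (auto simp: even_odd_pair_def axial_rep_def smooth_evenD(2))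
  \<comment> \<open>The odd part is v B; at \<open>x = 0\<close> both sides are 0, so the value of
    the quotient there is harmless.\<close>
  have "vec_action (x /\<^sub>R norm x) (norm x *\<^sub>R c) = vec_action x c" for x c
    by (cases "x = 0") (simp_all add: vec_action.scaleR_left vec_action.scaleR_right vec_action.zero_left)
  then show "\<forall>(x0, x)\<in>U. g (x0, x) = A (x0, norm x) +
      vec_action (x /\<^sub>R norm x) (snd (x0, norm x) *\<^sub>R B (x0, norm x))"
    using assms by (auto simp: axial_rep_def agree_def axial_lift_def)
qed

text \<open>The Fueter-Sce theorem, with the Dirac operator applied before the power of the
  Laplacian.\<close>

lemma fueter_sce:
  assumes "CARD('n) = 2 * h + 1" "h \<ge> 1"
    and rep: "axial_rep \<alpha> (odd_quotient \<beta>) f"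
    and \<alpha>: "smooth_even \<alpha>" and \<beta>: "C_infinity \<beta> (slice_domain U)"
    and pair: "even_odd_pair \<alpha> \<beta> (slice_domain U)" "cauchy_riemann_pair \<alpha> \<beta> (slice_domain U)"
  shows "(laplacian ^^ h) (dirac 1 f) \<simeq> (\<lambda>x. 0)"
proof -
  define b where "b = odd_quotient \<beta>"
  have odd: "\<beta> (u, - v) = - \<beta> (u, v)" if "(u, v) \<in> slice_domain U" for u v
    using pair(1) that by (auto simp: even_odd_pair_def)
  have b: "smooth_even b"
    unfolding b_def by (rule smooth_even_odd_quotient[OF \<beta> odd])
  have \<beta>_eq: "\<beta> p = snd p *\<^sub>R b p" if "p \<in> slice_domain U" for p
    unfolding b_def using odd_quotient_times[of \<beta>, OF odd that] .
  have \<beta>_partial: "partial c \<beta> p = partial c (\<lambda>p. snd p *\<^sub>R b p) p" if "p \<in> slice_domain U" for p c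
    by (rule partial_cong[OF open_domain that \<beta>_eq])
  have \<alpha>u: "partial (1, 0) \<alpha> p = b p + (snd p)\<^sup>2 *\<^sub>R axial_deriv b p" if "p \<in> slice_domain U" for p
    using pair(2) \<beta>_partial[OF that] partial_snd_scaleR(2)[OF b that] that
    by (simp add: cauchy_riemann_pair_def)
  have \<alpha>v: "axial_deriv \<alpha> p = - partial (1, 0) b p" if "p \<in> slice_domain U" for p
  proof (rule axial_deriv_unique[OF \<alpha> _ that])
    show "smooth_even (\<lambda>p. - partial (1, 0) b p)"
      by (intro smooth_even_intros b)
    show "partial (0, 1) \<alpha> q = snd q *\<^sub>R - partial (1, 0) b q" if "q \<in> slice_domain U" for q
      using pair(2) \<beta>_partial[OF that] partial_snd_scaleR(1)[OF b that] that
      by (simp add: cauchy_riemann_pair_def)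
  qed
  have "axial_ode 3 b"
    unfolding axial_ode_def
  proof
    fix p assume p: "p \<in> slice_domain U"
    \<comment> \<open>Apply \<tau> to the first Cauchy-Riemann equation, written in terms of
      \<open>b\<close>. The left side becomes minus the second u-derivative of \<open>b\<close> by
      the other equation; on the right \<tau> b occurs 1 + 2 times.\<close>
    have "axial_deriv (partial (1, 0) \<alpha>) p = axial_deriv (\<lambda>p. b p + (snd p)\<^sup>2 *\<^sub>R axial_deriv b p) p"
      by (rule axial_deriv_cong[OF smooth_even_partial(1)[OF \<alpha>] \<alpha>u p])
    also have "\<dots> = axial_deriv b p + (2 *\<^sub>R axial_deriv b p + (snd p)\<^sup>2 *\<^sub>R axial_deriv (axial_deriv b) p)"
      using p by (simp add: axial_deriv_add axial_deriv_square smooth_even_intros b)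
    also have "axial_deriv (partial (1, 0) \<alpha>) p = partial (1, 0) (\<lambda>p. - partial (1, 0) b p) p"
      using axial_deriv_partial[OF \<alpha> p] partial_cong[OF open_domain p \<alpha>v] by simp
    also have "\<dots> = - partial (1, 0) (partial (1, 0) b) p"
      by (rule partial_bounded_linear[OF bounded_linear_minus[OF bounded_linear_ident]])
        (intro smooth_even_differentiable smooth_even_partial b p)
    finally show "partial (1, 0) (partial (1, 0) b) p + 3 *\<^sub>R axial_deriv b p +
        (snd p)\<^sup>2 *\<^sub>R axial_deriv (axial_deriv b) p = 0"
      using scaleR_add_left[of 1 2 "axial_deriv b p"] by (simp add: add_ac neg_eq_iff_add_eq_0)
  qed
  define c where "c = 1 - real CARD('n)"
  have "dirac 1 f \<simeq> axial_lift (\<lambda>p. c *\<^sub>R b p)"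
  proof -
    have "dirac 1 f x = axial_lift (\<lambda>p. c *\<^sub>R b p) x" if "x \<in> U" for x
      using axial_rep_dirac[OF rep, of 1] that \<alpha>u[OF slice_coordinates[OF that]]
        \<alpha>v[OF slice_coordinates[OF that]]
      by (simp add: axial_rep_def agree_def b_def[symmetric] axial_lift_def vec_action.zero_right
          c_def scaleR_diff_left)
    then show ?thesis
      by (simp add: agree_def)
  qed
  then have "(laplacian ^^ h) (dirac 1 f) \<simeq> (laplacian ^^ h) (axial_lift (\<lambda>p. c *\<^sub>R b p))"
    by (rule smooth_operatorD(2)[OF smooth_operator_funpow[OF smooth_operator_laplacian]])
  also have "\<dots> \<simeq> (\<lambda>x. 0)"
  proof -
    \<comment> \<open>Since n = 2h + 1, the parameter n - 2(h - 1) is 3.\<close>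
    have "axial_ode (real CARD('n) - 2 * real (h - 1)) (\<lambda>p. c *\<^sub>R b p)"
      using axial_ode_scaleR[OF b \<open>axial_ode 3 b\<close>, of c] assms(1,2) by (simp add: of_nat_diff)
    then have "(laplacian ^^ Suc (h - 1)) (axial_lift (\<lambda>p. c *\<^sub>R b p)) \<simeq> (\<lambda>x. 0)"
      by (intro laplacian_funpow_axial_lift smooth_even_intros b)
    then show ?thesis
      using assms(2) by simp
  qed
  finally show ?thesis .
qed

lemma slice_axial_rep:
  assumes \<beta>: "\<And>u v. (u, v) \<in> slice_domain U \<Longrightarrow> \<beta> (u, - v) = - \<beta> (u, v)"
    and "smooth_even \<alpha>" "C_infinity \<beta> (slice_domain U)"
    and f: "\<And>u v I. (u, v) \<in> slice_domain U \<Longrightarrow> norm I = 1 \<Longrightarrow>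
      f (u, v *\<^sub>R I) = \<alpha> (u, v) + vec_action I (\<beta> (u, v))"
  shows "axial_rep \<alpha> (odd_quotient \<beta>) f"
  unfolding axial_rep_def
proof (intro conjI)
  show "f \<simeq> (\<lambda>x. axial_lift \<alpha> x + vec_action (snd x) (axial_lift (odd_quotient \<beta>) x))"
    unfolding agree_def
  proof
    fix x assume x: "x \<in> U"
    define I where "I = (if snd x = 0 then axis undefined 1 else snd x /\<^sub>R norm (snd x))"
    have I: "norm I = 1" "norm (snd x) *\<^sub>R I = snd x"
      by (auto simp: I_def)
    note p = slice_coordinates[OF x]
    have "f x = axial_lift \<alpha> x + vec_action I (\<beta> (fst x, norm (snd x)))"
      using f[OF p I(1)] I(2) by (simp add: axial_lift_def)
    also have "\<beta> (fst x, norm (snd x)) = norm (snd x) *\<^sub>R axial_lift (odd_quotient \<beta>) x"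
      using odd_quotient_times[of \<beta>, OF \<beta> p] by (simp add: axial_lift_def)
    also have "vec_action I (norm (snd x) *\<^sub>R axial_lift (odd_quotient \<beta>) x) =
        vec_action (norm (snd x) *\<^sub>R I) (axial_lift (odd_quotient \<beta>) x)"
      by (simp only: vec_action.scaleR_left vec_action.scaleR_right)
    finally show "f x = axial_lift \<alpha> x + vec_action (snd x) (axial_lift (odd_quotient \<beta>) x)"
      by (simp only: I(2))
  qed
qed (use assms smooth_even_odd_quotient[OF assms(3) \<beta>] in auto)

text \<open>The condition \<open>m + s = Suc r\<close> leaves one D after \<open>r\<close> pairs
  with the conjugate operator. The second form, for operators acting from the right, is brought to
  the first by commutation.\<close>

lemma dirac_laplacian_vanish:
  assumes f: "C_infinity f U" and vanish: "(laplacian ^^ h) (dirac 1 f) \<simeq> (\<lambda>x. 0)"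
    and "k + r = h" "m + s = Suc r"
  shows "(laplacian ^^ k) ((dirac 1 ^^ m) ((dirac 1 ^^ s) ((dirac (- 1) ^^ r) f))) \<simeq> (\<lambda>x. 0)"
    and "(dirac 1 ^^ m) ((laplacian ^^ k) ((dirac (- 1) ^^ r) ((dirac 1 ^^ s) f))) \<simeq> (\<lambda>x. 0)"
proof -
  let ?D = "dirac 1" and ?D' = "dirac (- 1)"
  note D = smooth_operator_dirac[of 1] smooth_operator_dirac[of "- 1"]
  note Dk = D[THEN smooth_operator_funpow] smooth_operator_laplacian[THEN smooth_operator_funpow]
  have eq: "(?D ^^ m) ((?D ^^ s) ((?D' ^^ r) f)) = (?D ^^ r) (?D ((?D' ^^ r) f))"
    using assms(4) by (metis comp_apply funpow_Suc_right funpow_add)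
  have "(?D ^^ r) (?D ((?D' ^^ r) f)) \<simeq> (?D ^^ r) ((?D' ^^ r) (?D f))"
    using dirac_funpow_commute[OF f, of 1 r] by (intro smooth_operatorD(2)[OF Dk(1)]) simp
  also have "\<dots> \<simeq> (laplacian ^^ r) (?D f)"
    by (intro dirac_funpow_dirac_funpow smooth_operatorD(1)[OF D(1)] f)
  finally have "(laplacian ^^ k) ((?D ^^ m) ((?D ^^ s) ((?D' ^^ r) f))) \<simeq> (laplacian ^^ k) ((laplacian ^^ r) (?D f))"
    unfolding eq by (rule smooth_operatorD(2)[OF Dk(3)])
  also have "(laplacian ^^ k) ((laplacian ^^ r) (?D f)) = (laplacian ^^ h) (?D f)"
    using assms(3) by (metis comp_apply funpow_add)
  also note vanish
  finally show left: "(laplacian ^^ k) ((?D ^^ m) ((?D ^^ s) ((?D' ^^ r) f))) \<simeq> (\<lambda>x. 0)" .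
  have "(?D ^^ m) ((laplacian ^^ k) ((?D' ^^ r) ((?D ^^ s) f))) \<simeq> (laplacian ^^ k) ((?D ^^ m) ((?D' ^^ r) ((?D ^^ s) f)))"
    using dirac_laplacian[of _ 1]
    by (intro funpow_commute D smooth_operator_laplacian smooth_operatorD(1)[OF Dk(1)] smooth_operatorD(1)[OF Dk(2)] f) simp
  also have "\<dots> \<simeq> (laplacian ^^ k) ((?D ^^ m) ((?D ^^ s) ((?D' ^^ r) f)))"
    by (intro smooth_operatorD(2)[OF Dk(3)] smooth_operatorD(2)[OF Dk(1)] agree_sym[OF dirac_funpow_commute] f)
  also note left
  finally show "(?D ^^ m) ((laplacian ^^ k) ((?D' ^^ r) ((?D ^^ s) f))) \<simeq> (\<lambda>x. 0)" .
qed

end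

text \<open>\<open>g\<close> and \<open>g'\<close> differ in the order of application: operators
  written on the left apply the conjugate first, those written on the right apply D first.\<close>

lemma (in clifford_action) slice_polyanalytic:
  assumes card: "CARD('n) = 2 * h + 1" and ls: "l + 1 \<le> h" "s + l < h"
    and \<alpha>\<beta>: "\<alpha> differentiable_on slice_domain U" "\<beta> differentiable_on slice_domain U"
      "even_odd_pair \<alpha> \<beta> (slice_domain U)" "cauchy_riemann_pair \<alpha> \<beta> (slice_domain U)"
    and f: "\<And>u v I. (u, v) \<in> slice_domain U \<Longrightarrow> norm I = 1 \<Longrightarrow>
      f (u, v *\<^sub>R I) = \<alpha> (u, v) + vec_action I (\<beta> (u, v))"
    and g: "g = (dirac 1 ^^ s) ((dirac (- 1) ^^ (h - l - 1)) f)"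
      "g' = (dirac (- 1) ^^ (h - l - 1)) ((dirac 1 ^^ s) f)"
  shows "C_infinity g U" "C_infinity g' U"
    "\<exists>A B. even_odd_pair A B (slice_domain U) \<and>
      (\<forall>(x0, x)\<in>U. g (x0, x) = A (x0, norm x) + vec_action (x /\<^sub>R norm x) (B (x0, norm x)))"
    "\<exists>A B. even_odd_pair A B (slice_domain U) \<and>
      (\<forall>(x0, x)\<in>U. g' (x0, x) = A (x0, norm x) + vec_action (x /\<^sub>R norm x) (B (x0, norm x)))"
    "\<forall>x\<in>U. (laplacian ^^ (l + 1)) ((dirac 1 ^^ (h - s - l)) g) x = 0"
    "\<forall>x\<in>U. (dirac 1 ^^ (h - s - l)) ((laplacian ^^ (l + 1)) g') x = 0"
proof -
  have smooth: "C_infinity \<alpha> (slice_domain U)" "C_infinity \<beta> (slice_domain U)"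
    using cauchy_riemann_pair_C_infinity[OF open_domain] \<alpha>\<beta> by blast+
  have \<alpha>: "smooth_even \<alpha>"
    using smooth(1) \<alpha>\<beta>(3) by (auto simp: smooth_even_def even_odd_pair_def)
  have \<beta>: "\<beta> (u, - v) = - \<beta> (u, v)" if "(u, v) \<in> slice_domain U" for u v
    using \<alpha>\<beta>(3) that by (auto simp: even_odd_pair_def)
  have rep: "axial_rep \<alpha> (odd_quotient \<beta>) f"
    by (rule slice_axial_rep[OF \<beta> \<alpha> smooth(2) f])
  have "\<exists>A B. axial_rep A B g" "\<exists>A B. axial_rep A B g'"
    unfolding g using rep by (intro axial_rep_dirac_funpow; blast)+
  then show "C_infinity g U" "C_infinity g' U"
    "\<exists>A B. even_odd_pair A B (slice_domain U) \<and>
      (\<forall>(x0, x)\<in>U. g (x0, x) = A (x0, norm x) + vec_action (x /\<^sub>R norm x) (B (x0, norm x)))"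
    "\<exists>A B. even_odd_pair A B (slice_domain U) \<and>
      (\<forall>(x0, x)\<in>U. g' (x0, x) = A (x0, norm x) + vec_action (x /\<^sub>R norm x) (B (x0, norm x)))"
    using axial_rep_C_infinity axial_rep_axial_form by blast+
  have "(laplacian ^^ h) (dirac 1 f) \<simeq> (\<lambda>x. 0)"
    using ls by (intro fueter_sce[OF card _ rep \<alpha> smooth(2) \<alpha>\<beta>(3,4)]) simp
  from dirac_laplacian_vanish[OF axial_rep_C_infinity[OF rep] this, of "l + 1" "h - l - 1" "h - s - l" s] ls
  show "\<forall>x\<in>U. (laplacian ^^ (l + 1)) ((dirac 1 ^^ (h - s - l)) g) x = 0"
    "\<forall>x\<in>U. (dirac 1 ^^ (h - s - l)) ((laplacian ^^ (l + 1)) g') x = 0"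
    by (simp_all add: agree_def g)
qed

lemma clifford_gen_anticommute_mult:
  "clifford_gen i * (clifford_gen j * c) + clifford_gen j * (clifford_gen i * c) = (if i = j then - 2 *\<^sub>R c else 0)"
  "c * clifford_gen j * clifford_gen i + c * clifford_gen i * clifford_gen j = (if i = j then - 2 *\<^sub>R c else 0)"
proof -
  have "clifford_gen i * (clifford_gen j * c) + clifford_gen j * (clifford_gen i * c) =
      (clifford_gen i * clifford_gen j + clifford_gen j * clifford_gen i) * c"
    by (simp add: algebra_simps)
  then show "clifford_gen i * (clifford_gen j * c) + clifford_gen j * (clifford_gen i * c) =
      (if i = j then - 2 *\<^sub>R c else 0)"
    by (simp add: clifford_gen_anticommute scaleR_2 mult_2)
  have "c * clifford_gen j * clifford_gen i + c * clifford_gen i * clifford_gen j =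
      c * (clifford_gen i * clifford_gen j + clifford_gen j * clifford_gen i)"
    by (simp add: algebra_simps)
  then show "c * clifford_gen j * clifford_gen i + c * clifford_gen i * clifford_gen j =
      (if i = j then - 2 *\<^sub>R c else 0)"
    by (simp add: clifford_gen_anticommute scaleR_2 mult_2_right)
qed

theorem theorem6p5:
  fixes U :: "('n::{finite,linorder}) paravector set"
    and f :: "'n clifford_fun"
    and n h l s :: nat
  assumes "n = CARD('n)" and "odd n" and "h = (n - 1) div 2"
    and "int l \<le> int h - 2" and "int s \<le> int h - 1" and "s + l < h"
    and "open U" and "axially_symmetric U"
  shows
    "(left_slice_hyperholomorphic f U \<longrightarrow>
        left_axially_polyanalytic_cliffordian (l + 1) (h - s - l)
          ((dirac_left ^^ s) ((dirac_bar_left ^^ (h - l - 1)) f)) U) \<and>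
     (right_slice_hyperholomorphic f U \<longrightarrow>
        right_axially_polyanalytic_cliffordian (l + 1) (h - s - l)
          ((dirac_bar_right ^^ (h - l - 1)) ((dirac_right ^^ s) f)) U)"
proof -
  interpret axial_clifford_domain U
    using assms(7,8) by unfold_locales
  interpret L: clifford_action U "\<lambda>i c. clifford_gen i * c"
  proof (intro clifford_action.intro clifford_action_axioms.intro axial_clifford_domain_axioms)
    show "linear (\<lambda>c. clifford_gen i * c)" for i :: 'n
      by (rule linearI) (simp_all add: distrib_left)
  qed (rule clifford_gen_anticommute_mult)
  interpret R: clifford_action U "\<lambda>i c. c * clifford_gen i"
  proof (intro clifford_action.intro clifford_action_axioms.intro axial_clifford_domain_axioms)
    show "linear (\<lambda>c. c * clifford_gen i)" for i :: 'n
      by (rule linearI) (simp_all add: distrib_right)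
  qed (rule clifford_gen_anticommute_mult)
  \<comment> \<open>The bound on \<open>l\<close> is an integer inequality, so it yields
    \<open>l + 1 \<le> h\<close> and the natural subtraction \<open>h - l - 1\<close> does not
    truncate.\<close>
  have card: "CARD('n) = 2 * h + 1" and l: "l + 1 \<le> h"
    using assms(1-6) by auto
  have L: "dirac_left = L.dirac 1" "dirac_bar_left = L.dirac (- 1)"
    and R: "dirac_right = R.dirac 1" "dirac_bar_right = R.dirac (- 1)"
    by (simp_all add: fun_eq_iff dirac_left_def dirac_bar_left_def dirac_right_def dirac_bar_right_def
        L.dirac_def R.dirac_def)
  have vec: "L.vec_action v c = clifford_vec v * c" "R.vec_action v c = c * clifford_vec v" for v c
    by (simp_all add: L.vec_action_def R.vec_action_def clifford_vec_def sum_distrib_left sum_distrib_right)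
  show ?thesis
  proof (intro conjI impI)
    assume "left_slice_hyperholomorphic f U"
    then obtain \<alpha> \<beta> where
      "\<alpha> differentiable_on slice_domain U" "\<beta> differentiable_on slice_domain U"
      "even_odd_pair \<alpha> \<beta> (slice_domain U)" "cauchy_riemann_pair \<alpha> \<beta> (slice_domain U)"
      "\<And>u v I. (u, v) \<in> slice_domain U \<Longrightarrow> norm I = 1 \<Longrightarrow> f (u, v *\<^sub>R I) = \<alpha> (u, v) + L.vec_action I (\<beta> (u, v))"
      unfolding left_slice_hyperholomorphic_def vec by force
    from L.slice_polyanalytic[OF card l assms(6) this refl refl]
    show "left_axially_polyanalytic_cliffordian (l + 1) (h - s - l)
        ((dirac_left ^^ s) ((dirac_bar_left ^^ (h - l - 1)) f)) U"
      unfolding left_axially_polyanalytic_cliffordian_def left_axial_form_def L vec C_infinity_def by blast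
  next
    assume "right_slice_hyperholomorphic f U"
    then obtain \<alpha> \<beta> where
      "\<alpha> differentiable_on slice_domain U" "\<beta> differentiable_on slice_domain U"
      "even_odd_pair \<alpha> \<beta> (slice_domain U)" "cauchy_riemann_pair \<alpha> \<beta> (slice_domain U)"
      "\<And>u v I. (u, v) \<in> slice_domain U \<Longrightarrow> norm I = 1 \<Longrightarrow> f (u, v *\<^sub>R I) = \<alpha> (u, v) + R.vec_action I (\<beta> (u, v))"
      unfolding right_slice_hyperholomorphic_def vec by force
    from R.slice_polyanalytic[OF card l assms(6) this refl refl]
    show "right_axially_polyanalytic_cliffordian (l + 1) (h - s - l)
        ((dirac_bar_right ^^ (h - l - 1)) ((dirac_right ^^ s) f)) U"
      unfolding right_axially_polyanalytic_cliffordian_def right_axial_form_def R vec C_infinity_def by blast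
  qed
qed

end
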